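(* For every $(\lambda,f,F)\in\Omega_0=\{(\lambda,f,F)\in\mathbb R^3 : F\ge |f|\}$ one has $$\mathcal B_0(\lambda,f,F)=B_0(\lambda,f,F),$$ where $$\mathcal B_0(\lambda,f,F)=\sup\Big|\Big\{x\in I_0:\ \sum_{I\subset I_0,\ I\in D}\varepsilon_I(\varphi,h_I)h_I(x)\ge\lambda\Big\}\Big|,$$ the supremum being over all families $\{\varepsilon_I\}$ with $|\varepsilon_I|=1$ and all functions $\varphi$ on $I_0$ with $\langle|\varphi|\rangle_{I_0}=F$ and $\langle\varphi\rangle_{I_0}=f$, and $$B_0(\lambda,f,F)=\begin{cases}1,&\lambda\le F,\\ 1-\dfrac{(\lambda-F)^2}{\lambda^2-f^2},&\lambda> F.\end{cases}$$
   Context: $I_0=[0,1]$; $D$ is the collection of dyadic intervals; $|\cdot|$ applied to sets is Lebesgue measure. For a dyadic interval $I$ with left half $I_-$ and right half $I_+$, the Haar function is $h_I=|I|^{-1/2}$ on $I_+$, $h_I=-|I|^{-1/2}$ on $I_-$, and $0$ off $I$. $(\varphi,h_I)=\int\varphi h_I$, and $\langle\varphi\rangle_J=\frac1{|J|}\int_J\varphi$. Functions $\varphi$ are real-valued and integrable on $I_0$, and $\varepsilon_I\in\{-1,1\}$. The Haar sum is understood as the almost everywhere limit, as $n\to\infty$, of the partial sums over dyadic $I\subset I_0$ with $|I|\ge 2^{-n}$ (this limit exists a.e. for $\varphi\in L^1(I_0)$). *)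

theory Defs
  imports "HOL-Analysis.Analysis"
begin

abbreviation leb :: "real set \<Rightarrow> real" where
  "leb \<equiv> measure lebesgue"

definition I0 :: "real set" where
  "I0 = {0..1}"

text \<open>Dyadic intervals of all integer scales are taken half-open, so that the two halves of a
  dyadic interval partition it. A different convention at the endpoints would alter the partial
  sums below only at countably many points.\<close>

definition dyadic_intervals :: "real set set" where
  "dyadic_intervals =
     {{of_int k * 2 powi (- n) ..< (of_int k + 1) * 2 powi (- n)} | (n::int) (k::int). True}"

definition left_half :: "real set \<Rightarrow> real set" where
  "left_half I = {Inf I ..< (Inf I + Sup I) / 2}"

definition right_half :: "real set \<Rightarrow> real set" where
  "right_half I = {(Inf I + Sup I) / 2 ..< Sup I}"

definition haar :: "real set \<Rightarrow> real \<Rightarrow> real" where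
  "haar I x =
     (if x \<in> right_half I then leb I powr (- 1 / 2)
      else if x \<in> left_half I then - (leb I powr (- 1 / 2))
      else 0)"

text \<open>Functions on \<open>I0\<close> are represented by functions on the whole real line, whose values
  outside \<open>I0\<close> are irrelevant; hence the explicit restriction of the integral to \<open>I0\<close>.\<close>

definition haar_coeff :: "(real \<Rightarrow> real) \<Rightarrow> real set \<Rightarrow> real" where
  "haar_coeff \<phi> I = (LINT x:I0|lebesgue. \<phi> x * haar I x)"

definition average :: "(real \<Rightarrow> real) \<Rightarrow> real set \<Rightarrow> real" where
  "average \<phi> J = 1 / leb J * (LINT x:J|lebesgue. \<phi> x)"

definition dyadic_upto :: "nat \<Rightarrow> real set set" where
  "dyadic_upto n = {I \<in> dyadic_intervals. I \<subseteq> I0 \<and> leb I \<ge> 1 / 2 ^ n}"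

lemma finite_dyadic_upto: "finite (dyadic_upto n)"
proof -
  let ?J = "\<lambda>(j::int, k::int). {of_int k * 2 powi (- j) ..< (of_int k + 1) * 2 powi (- j) :: real}"
  have "dyadic_upto n \<subseteq> ?J ` ({0..int n} \<times> {0..2 ^ n})"
  proof
    fix I assume I: "I \<in> dyadic_upto n"
    then obtain j k :: int where Ieq: "I = ?J (j, k)"
      by (auto simp: dyadic_upto_def dyadic_intervals_def)
    define d :: real where "d = 2 powi (- j)"
    have d: "d > 0" by (simp add: d_def)
    have Id: "I = {of_int k * d ..< of_int k * d + d}"
      by (simp add: Ieq d_def algebra_simps)
    have sub: "{of_int k * d ..< of_int k * d + d} \<subseteq> {0..1}" and "leb I \<ge> 1 / 2 ^ n"
      using I by (simp_all add: dyadic_upto_def I0_def Id)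
    have "closure {of_int k * d ..< of_int k * d + d} \<subseteq> {0..1}"
      using sub by (rule closure_minimal) simp
    hence lo: "0 \<le> of_int k * d" and hi: "of_int k * d + d \<le> 1"
      using d by (simp_all)
    have dn: "d \<ge> 1 / 2 ^ n"
      using \<open>leb I \<ge> 1 / 2 ^ n\<close> d by (simp add: Id)
    have k0: "k \<ge> 0" using lo d by (simp add: zero_le_mult_iff)
    have "d \<le> 1" using hi lo by linarith
    have j0: "j \<ge> 0"
    proof (rule ccontr)
      assume "\<not> j \<ge> 0"
      hence "d > 1" unfolding d_def by (intro one_less_power_int) auto
      thus False using \<open>d \<le> 1\<close> by simp
    qed
    have deq: "d = 1 / 2 ^ nat j"
      using j0 by (simp add: d_def power_int_minus power_int_nonneg_exp inverse_eq_divide)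
    have "(2::real) ^ nat j \<le> 2 ^ n"
      using dn by (simp add: deq field_simps)
    hence jn: "j \<le> int n" using j0 by simp
    have "of_int k * (1 / 2 ^ n) \<le> of_int k * d"
      using dn k0 by (intro mult_left_mono) auto
    also have "\<dots> \<le> 1" using hi d by linarith
    finally have "real_of_int k \<le> 2 ^ n" by (simp add: field_simps)
    hence "k \<le> 2 ^ n"
      using of_int_le_iff[of k "2 ^ n", where ?'a = real] by simp
    with k0 j0 jn have "(j, k) \<in> {0..int n} \<times> {0..2 ^ n}" by simp
    with Ieq show "I \<in> ?J ` ({0..int n} \<times> {0..2 ^ n})" by (rule image_eqI)
  qed
  thus ?thesis by (rule finite_subset) auto
qed

definition haar_partial_sum ::
    "(real set \<Rightarrow> real) \<Rightarrow> (real \<Rightarrow> real) \<Rightarrow> nat \<Rightarrow> real \<Rightarrow> real" where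
  "haar_partial_sum \<epsilon> \<phi> n x = (\<Sum>I\<in>dyadic_upto n. \<epsilon> I * haar_coeff \<phi> I * haar I x)"

text \<open>The Haar sum at \<open>x\<close> is the limit of the partial sums. It exists for almost every \<open>x\<close>;
  the points without a limit are left out of the superlevel set, which does not affect
  its measure.\<close>

definition superlevel_set ::
    "(real set \<Rightarrow> real) \<Rightarrow> (real \<Rightarrow> real) \<Rightarrow> real \<Rightarrow> real set" where
  "superlevel_set \<epsilon> \<phi> lam =
     {x \<in> I0. convergent (\<lambda>n. haar_partial_sum \<epsilon> \<phi> n x) \<and>
              lim (\<lambda>n. haar_partial_sum \<epsilon> \<phi> n x) \<ge> lam}"

definition signs :: "(real set \<Rightarrow> real) set" where
  "signs = {\<epsilon>. \<forall>I\<in>dyadic_intervals. I \<subseteq> I0 \<longrightarrow> \<epsilon> I \<in> {-1, 1}}"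

definition admissible :: "real \<Rightarrow> real \<Rightarrow> (real \<Rightarrow> real) set" where
  "admissible f F =
     {\<phi>. set_integrable lebesgue I0 \<phi> \<and> average (\<lambda>x. \<bar>\<phi> x\<bar>) I0 = F \<and> average \<phi> I0 = f}"

definition Omega0 :: "(real \<times> real \<times> real) set" where
  "Omega0 = {(lam, f, F). F \<ge> \<bar>f\<bar>}"

definition Bellman :: "real \<Rightarrow> real \<Rightarrow> real \<Rightarrow> real" where
  "Bellman lam f F =
     (SUP (\<epsilon>, \<phi>) \<in> signs \<times> admissible f F. leb (superlevel_set \<epsilon> \<phi> lam))"

definition B0 :: "real \<Rightarrow> real \<Rightarrow> real \<Rightarrow> real" where
  "B0 lam f F =
     (if lam \<le> F then 1 else 1 - (lam - F)\<^sup>2 / (lam\<^sup>2 - f\<^sup>2))"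

end

theory Submission imports Defs begin

text \<open>
  Splitting the unit interval into its halves shows that the Bellman function is midpoint concave
  along all segments on which \<open>\<lambda>\<close> and \<open>f\<close> change by the same absolute amount, while \<open>F\<close> is free: a
  jump of the mean of \<open>\<phi>\<close> between the halves is the coefficient of the top Haar function, and its
  sign can be chosen at will. The function \<open>B0\<close> is the least nonnegative function on the domain with
  this concavity whose value is at least 1 at the points \<open>(\<lambda>, 0, 0)\<close>, \<open>\<lambda> \<le> 0\<close>.

  For \<open>B0 \<le> Bellman\<close>, the value 1 is propagated from these points along rays, on which a
  nonnegative concave function cannot decrease, and then interpolated along two further segments. For
  \<open>Bellman \<le> B0\<close>, the concavity of \<open>B0\<close>, which reduces to the convexity of \<open>a\<^sup>2 / q\<close>, bounds the
  superlevel sets of the partial sums by induction on the number of dyadic scales. The bound passes to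
  the limit because \<open>B0\<close> is left-continuous in \<open>\<lambda>\<close>.
\<close>

subsection \<open>Concavity along zigzag directions\<close>

text \<open>Boundedness below takes the place of continuity. The deviation \<open>h\<close> from the
  chord vanishes at 0 and 1 and has a finite infimum \<open>m\<close>; every point of the interval
  is the midpoint of an endpoint and a point of the interval, so \<open>h\<close> is at least
  \<open>m / 2\<close> everywhere. Hence \<open>m / 2 \<le> m\<close>, which forces \<open>m\<close>
  to be nonnegative.\<close>

lemma midpoint_concave_bounded_below_above_chord:
  fixes g :: "real \<Rightarrow> real"
  assumes lower: "\<And>t. t \<in> {0..1} \<Longrightarrow> c \<le> g t"
    and mid: "\<And>s t. s \<in> {0..1} \<Longrightarrow> t \<in> {0..1} \<Longrightarrow> (g s + g t) / 2 \<le> g ((s + t) / 2)"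
    and t: "t \<in> {0..1}"
  shows "(1 - t) * g 0 + t * g 1 \<le> g t"
proof -
  define h where "h = (\<lambda>t. g t - ((1 - t) * g 0 + t * g 1))"
  define m where "m = (INF t\<in>{0..1}. h t)"
  have hmid: "(h s + h t) / 2 \<le> h ((s + t) / 2)" if "s \<in> {0..1}" "t \<in> {0..1}" for s t
    using mid[OF that] by (simp add: h_def field_simps)
  have bound: "(1 - t) * g 0 + t * g 1 \<le> \<bar>g 0\<bar> + \<bar>g 1\<bar>" if "t \<in> {0..1}" for t
  proof -
    have "s * x \<le> \<bar>x\<bar>" if "s \<in> {0..1}" for s x :: real
    proof -
      have "\<bar>s\<bar> * \<bar>x\<bar> \<le> 1 * \<bar>x\<bar>" using that by (intro mult_right_mono) auto
      thus ?thesis using abs_ge_self[of "s * x"] by (simp add: abs_mult)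
    qed
    from this[of "1 - t" "g 0"] this[of t "g 1"] that show ?thesis by simp
  qed
  have bdd: "bdd_below (h ` {0..1})"
  proof (rule bdd_belowI2)
    fix t :: real assume t: "t \<in> {0..1}"
    show "c - (\<bar>g 0\<bar> + \<bar>g 1\<bar>) \<le> h t"
      using lower[OF t] bound[OF t] by (simp add: h_def)
  qed
  have m_le: "m \<le> h t" if "t \<in> {0..1}" for t
    unfolding m_def using bdd that by (rule cINF_lower)
  have "m / 2 \<le> m"
    unfolding m_def
  proof (rule cINF_greatest)
    fix t :: real assume t: "t \<in> {0..1}"
    show "(INF t\<in>{0..1}. h t) / 2 \<le> h t"
    proof (cases "t \<le> 1 / 2")
      case True
      thus ?thesis using hmid[of 0 "2 * t"] m_le[of "2 * t"] t by (simp add: h_def m_def)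
    next
      case False
      thus ?thesis using hmid[of "2 * t - 1" 1] m_le[of "2 * t - 1"] t by (simp add: h_def m_def)
    qed
  qed simp
  with m_le[OF t] show ?thesis by (simp add: h_def)
qed

text \<open>The properties from which the lower bound is derived; \<open>Bellman\<close> is shown to
  have them later. Nonnegativity is also what turns midpoint concavity into concavity.\<close>

locale zigzag_concave =
  fixes b :: "real \<Rightarrow> real \<Rightarrow> real \<Rightarrow> real"
  assumes nonneg: "\<bar>f\<bar> \<le> F \<Longrightarrow> 0 \<le> b l f F"
    and at_origin: "l \<le> 0 \<Longrightarrow> 1 \<le> b l 0 0"
    and midpoint: "\<bar>f\<bar> \<le> F \<Longrightarrow> \<bar>f'\<bar> \<le> F' \<Longrightarrow> \<bar>l - l'\<bar> = \<bar>f - f'\<bar> \<Longrightarrow>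
      (b l f F + b l' f' F') / 2 \<le> b ((l + l') / 2) ((f + f') / 2) ((F + F') / 2)"
begin

text \<open>Along a segment \<open>l\<close> and \<open>f\<close> change in proportion to the
  parameter, so any two of its points inherit the slope condition; the domain is convex.\<close>

lemma segment:
  assumes d: "\<bar>f\<bar> \<le> F" "\<bar>f'\<bar> \<le> F'" "\<bar>l - l'\<bar> = \<bar>f - f'\<bar>" and t: "t \<in> {0..1}"
  shows "(1 - t) * b l f F + t * b l' f' F'
    \<le> b ((1 - t) * l + t * l') ((1 - t) * f + t * f') ((1 - t) * F + t * F')"
proof -
  define g where "g = (\<lambda>t. b ((1 - t) * l + t * l') ((1 - t) * f + t * f') ((1 - t) * F + t * F'))"
  have dom: "\<bar>(1 - t) * f + t * f'\<bar> \<le> (1 - t) * F + t * F'" if "t \<in> {0..1}" for t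
  proof -
    have "\<bar>(1 - t) * f + t * f'\<bar> \<le> (1 - t) * \<bar>f\<bar> + t * \<bar>f'\<bar>"
      using that by (intro order_trans[OF abs_triangle_ineq]) (simp add: abs_mult)
    also have "\<dots> \<le> (1 - t) * F + t * F'"
      using that d by (intro add_mono mult_left_mono) auto
    finally show ?thesis .
  qed
  have "(1 - t) * g 0 + t * g 1 \<le> g t"
  proof (rule midpoint_concave_bounded_below_above_chord[where c = 0])
    fix s t :: real assume st: "s \<in> {0..1}" "t \<in> {0..1}"
    have "\<bar>((1 - s) * l + s * l') - ((1 - t) * l + t * l')\<bar> = \<bar>(s - t) * (l - l')\<bar>"
      by (subst abs_minus_commute) (simp add: algebra_simps)
    also have "\<dots> = \<bar>(s - t) * (f - f')\<bar>" by (simp add: abs_mult d)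
    also have "\<dots> = \<bar>((1 - s) * f + s * f') - ((1 - t) * f + t * f')\<bar>"
      by (subst abs_minus_commute) (simp add: algebra_simps)
    finally have slope: "\<bar>((1 - s) * l + s * l') - ((1 - t) * l + t * l')\<bar>
      = \<bar>((1 - s) * f + s * f') - ((1 - t) * f + t * f')\<bar>" .
    have comb: "((1 - s) * x + s * y + ((1 - t) * x + t * y)) / 2
        = (1 - (s + t) / 2) * x + (s + t) / 2 * y" for x y :: real
      by (simp add: field_simps)
    show "(g s + g t) / 2 \<le> g ((s + t) / 2)"
      using midpoint[OF dom[OF st(1)] dom[OF st(2)] slope] by (simp only: g_def comb)
  next
    show "0 \<le> g t" if "t \<in> {0..1}" for t
      unfolding g_def using dom[OF that] by (rule nonneg)
  qed (rule t)
  thus ?thesis by (simp add: g_def)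
qed

text \<open>A nonnegative concave function on a half-line cannot fall: comparison with a far point,
  whose value counts as 0, loses an arbitrarily small fraction. The direction
  \<open>(1, \<sigma>, 1)\<close> never leaves the domain.\<close>

lemma ray:
  assumes d: "\<bar>f\<bar> \<le> F" "\<bar>\<sigma>\<bar> = 1" and s: "s \<ge> 0" and one: "1 \<le> b l f F"
  shows "1 \<le> b (l + s) (f + \<sigma> * s) (F + s)"
proof (cases "s = 0")
  case False
  have "1 - e \<le> b (l + s) (f + \<sigma> * s) (F + s)" if e: "0 < e" "e < 1" for e
  proof -
    \<comment> \<open>The far endpoint is placed so that it receives weight \<open>e\<close> at the
      point at distance \<open>s\<close>.\<close>
    define T where "T = s / e"
    have T: "T > 0" "e * T = s" using e s False by (simp_all add: T_def)
    have "\<bar>f + \<sigma> * T\<bar> \<le> F + T"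
      using d T by (auto simp: abs_if split: if_splits)
    from segment[OF d(1) this, of l "l + T" e]
    have "(1 - e) * b l f F + e * b (l + T) (f + \<sigma> * T) (F + T)
      \<le> b (l + e * T) (f + \<sigma> * (e * T)) (F + e * T)"
      using d e by (simp add: algebra_simps abs_mult)
    moreover have "0 \<le> e * b (l + T) (f + \<sigma> * T) (F + T)"
      using e nonneg[OF \<open>\<bar>f + \<sigma> * T\<bar> \<le> F + T\<close>] by simp
    moreover have "(1 - e) * 1 \<le> (1 - e) * b l f F" using one e by (intro mult_left_mono) auto
    ultimately show ?thesis using T by simp
  qed
  note near = this
  show ?thesis
  proof (rule ccontr)
    define y where "y = b (l + s) (f + \<sigma> * s) (F + s)"
    assume "\<not> ?thesis"
    hence "y < 1" by (simp add: y_def)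
    \<comment> \<open>For \<open>y > 0\<close> the choice \<open>e = (1 - y) / 2\<close> is below 1
      and gives \<open>1 - e > y\<close>; for \<open>y \<le> 0\<close> already
      \<open>e = 1 / 2\<close> is contradictory.\<close>
    thus False using near[of "1 / 2"] near[of "(1 - y) / 2"] by (cases "y \<le> 0") (auto simp: y_def[symmetric] field_simps)
  qed
qed (use one in simp)

text \<open>One ray of length \<open>F\<close>, issued from \<open>(l - F, 0, 0)\<close>.\<close>

lemma one_le_edge:
  assumes "l \<le> F" "F \<ge> 0" "\<bar>\<sigma>\<bar> = 1"
  shows "1 \<le> b l (\<sigma> * F) F"
  using ray[of 0 0 \<sigma> F "l - F"] assms at_origin[of "l - F"] by simp

text \<open>A second ray, in direction \<open>(1, 1, 1)\<close>, leaves the edge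
  \<open>f = - F\<close> and reaches the point; its start satisfies the condition of
  \<open>one_le_edge\<close> exactly because \<open>l \<le> F\<close>.\<close>

lemma one_le:
  assumes "\<bar>f\<bar> \<le> F" "l \<le> F"
  shows "1 \<le> b l f F"
proof -
  have "1 \<le> b (l - (F + f) / 2) (- 1 * ((F - f) / 2)) ((F - f) / 2)"
    using assms by (intro one_le_edge) (auto simp: field_simps)
  from ray[OF _ _ _ this, of 1 "(F + f) / 2"] assms show ?thesis
    by (simp add: field_simps)
qed

text \<open>With \<open>l + f\<close> fixed, the point lies between \<open>(2 * w, 0, 0)\<close>,
  where only nonnegativity is known, and \<open>(w, w, w)\<close>, where the value is at least 1;
  \<open>t\<close> is the weight of the latter. The resulting bound is
  \<open>B0 l f f\<close>.\<close>

lemma diagonal: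
  assumes "0 \<le> f" "f < l"
  shows "2 * f / (l + f) \<le> b l f f"
proof -
  define w where "w = (l + f) / 2"
  define t where "t = f / w"
  have w: "w > 0" and tw: "t * w = f" and t: "t \<in> {0..1}"
    using assms by (auto simp: t_def w_def field_simps)
  have "(1 - t) * b (2 * w) 0 0 + t * b w w w
      \<le> b ((1 - t) * (2 * w) + t * w) ((1 - t) * 0 + t * w) ((1 - t) * 0 + t * w)"
    using w t by (intro segment) auto
  also have "(1 - t) * (2 * w) + t * w = 2 * w - t * w" by (simp add: algebra_simps)
  also have "\<dots> = l" unfolding tw by (simp add: w_def field_simps)
  also have "(1 - t) * 0 + t * w = f" by (simp add: tw)
  finally have "(1 - t) * b (2 * w) 0 0 + t * b w w w \<le> b l f f" .
  moreover have "0 \<le> (1 - t) * b (2 * w) 0 0" using t nonneg[of 0 0] by simp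
  moreover have "t * 1 \<le> t * b w w w" using one_le[of w w w] w t by (intro mult_left_mono) auto
  moreover have "t = 2 * f / (l + f)" by (simp add: t_def w_def)
  ultimately show ?thesis by linarith
qed

lemma B0_le:
  assumes fF: "\<bar>f\<bar> \<le> F"
  shows "B0 l f F \<le> b l f F"
proof (cases "l \<le> F")
  case True
  thus ?thesis using one_le[OF fF] by (simp add: B0_def)
next
  case False
  \<comment> \<open>The segment used below keeps \<open>l - f = u\<close>. Along it
    \<open>l - F\<close> runs from 0 to \<open>u\<close> and \<open>l + f\<close> from 0 to
    \<open>w\<close>, so matching \<open>F\<close> fixes the weight \<open>s\<close>, and matching
    \<open>l + f = v\<close> fixes \<open>w\<close>.\<close>
  define u where "u = l - f"
  define v where "v = l + f"
  define s where "s = (l - F) / u"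
  define w where "w = v / s"
  have uv: "u > 0" "v > 0" using fF False by (auto simp: u_def v_def)
  have s: "0 < s" "s \<le> 1" using fF False uv by (auto simp: s_def u_def divide_le_eq)
  have su: "s * u = l - F" using uv by (simp add: s_def)
  have sw: "s * w = v" using s by (simp add: w_def)
  \<comment> \<open>This puts the endpoint on the face \<open>f = F\<close> inside the domain: its
    last coordinate \<open>(w - u) / 2\<close> must be nonnegative.\<close>
  have wu: "w \<ge> u"
  proof -
    have "s * u \<le> s * w" using fF by (simp add: su sw v_def)
    thus ?thesis using s by simp
  qed
  txt \<open>The point lies on the segment from \<open>(u/2, -u/2, u/2)\<close>, where the value is at least 1, to a
    point of the face \<open>f = F\<close>.\<close>
  have "(1 - s) * b (u / 2) (- u / 2) (u / 2) + s * b ((u + w) / 2) ((w - u) / 2) ((w - u) / 2)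
    \<le> b ((1 - s) * (u / 2) + s * ((u + w) / 2)) ((1 - s) * (- u / 2) + s * ((w - u) / 2))
        ((1 - s) * (u / 2) + s * ((w - u) / 2))"
    using uv wu s by (intro segment) (auto simp: field_simps)
  also have "(1 - s) * (u / 2) + s * ((u + w) / 2) = (u + s * w) / 2" by (simp add: field_simps)
  also have "\<dots> = l" by (simp add: sw u_def v_def)
  also have "(1 - s) * (- u / 2) + s * ((w - u) / 2) = (s * w - u) / 2" by (simp add: field_simps)
  also have "\<dots> = f" by (simp add: sw u_def v_def)
  also have "(1 - s) * (u / 2) + s * ((w - u) / 2) = (u + s * w) / 2 - s * u"
    by (simp add: field_simps)
  also have "\<dots> = F" unfolding sw su by (simp add: u_def v_def)
  finally have *: "(1 - s) * b (u / 2) (- u / 2) (u / 2)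
    + s * b ((u + w) / 2) ((w - u) / 2) ((w - u) / 2) \<le> b l f F" .
  have "(1 - s) * 1 \<le> (1 - s) * b (u / 2) (- u / 2) (u / 2)"
    using s uv by (intro mult_left_mono one_le) auto
  moreover have "(w - u) / w \<le> b ((u + w) / 2) ((w - u) / 2) ((w - u) / 2)"
    using diagonal[of "(w - u) / 2" "(u + w) / 2"] uv wu by (simp add: field_simps)
  hence "s * ((w - u) / w) \<le> s * b ((u + w) / 2) ((w - u) / 2) ((w - u) / 2)"
    using s by (intro mult_left_mono) auto
  ultimately have "1 - s + s * ((w - u) / w) \<le> b l f F" using * by simp
  \<comment> \<open>Since \<open>s * w = v\<close>, the loss \<open>s * u / w\<close> equals
    \<open>(s * u)\<^sup>2 / (u * v)\<close>.\<close>
  moreover have "1 - s + s * ((w - u) / w) = 1 - s * s * u * u / (u * v)"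
    using s uv sw wu by (simp add: w_def field_simps)
  moreover have "s * s * u * u = (l - F)\<^sup>2" by (simp add: su[symmetric] power2_eq_square)
  moreover have "u * v = l\<^sup>2 - f\<^sup>2" by (simp add: u_def v_def power2_eq_square algebra_simps)
  ultimately show ?thesis using False by (simp add: B0_def)
qed

end

section \<open>Concavity and left continuity of \<open>B0\<close>\<close>

text \<open>For two positive numerators this is the Cauchy-Schwarz inequality. If one numerator
  \<open>c\<close> is nonpositive, its denominator may be lowered to \<open>c\<close>; removing
  \<open>c\<close> from numerator and denominator then increases the quotient because
  \<open>c' \<le> r'\<close>.\<close>

lemma square_over_linear_midpoint:
  fixes a a' q q' :: real
  assumes "a \<le> q" "a' \<le> q'" and a: "a + a' > 0"
  shows "(a + a')\<^sup>2 / (q + q') \<le> (if a \<le> 0 then 0 else a\<^sup>2 / q) + (if a' \<le> 0 then 0 else a'\<^sup>2 / q')"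
proof -
  have one_sided: "(c + c')\<^sup>2 / (r + r') \<le> c'\<^sup>2 / r'"
    if "c \<le> r" "c' \<le> r'" "c + c' > 0" "c \<le> 0" for c c' r r' :: real
  proof -
    \<comment> \<open>This is \<open>(c + c')\<^sup>2 / (c + r') \<le> c'\<^sup>2 / r'\<close> with
      denominators cleared.\<close>
    have "c'\<^sup>2 * (- c) \<le> r' * ((2 * c' + c) * (- c))"
    proof -
      have "c' * c' * (- c) \<le> r' * (2 * c' + c) * (- c)"
        using that by (intro mult_right_mono mult_mono) auto
      thus ?thesis by (simp add: power2_eq_square mult_ac)
    qed
    moreover have "c'\<^sup>2 * c \<le> c'\<^sup>2 * r" using that by (intro mult_left_mono) auto
    ultimately have "(c + c')\<^sup>2 * r' \<le> c'\<^sup>2 * (r + r')"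
      by (simp add: power2_eq_square algebra_simps)
    moreover have "r' > 0" "r + r' > 0" using that by auto
    ultimately show ?thesis by (simp add: divide_simps)
  qed
  consider "a \<le> 0" | "a' \<le> 0" | "a > 0" "a' > 0" by linarith
  thus ?thesis
  proof cases
    case 1
    thus ?thesis using one_sided[of a q a' q'] assms by auto
  next
    case 2
    thus ?thesis using one_sided[of a' q' a q] assms by (auto simp: add.commute)
  next
    case 3
    hence q: "q > 0" "q' > 0" using assms by auto
    have "0 \<le> (a * q' - a' * q)\<^sup>2" by simp
    hence "(a + a')\<^sup>2 * (q * q') \<le> (a\<^sup>2 * q' + a'\<^sup>2 * q) * (q + q')"
      by (simp add: power2_eq_square algebra_simps)
    hence "(a + a')\<^sup>2 / (q + q') \<le> (a\<^sup>2 * q' + a'\<^sup>2 * q) / (q * q')"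
      using q by (simp add: divide_simps)
    also have "\<dots> = a\<^sup>2 / q + a'\<^sup>2 / q'" using q by (simp add: field_simps)
    finally show ?thesis using 3 by simp
  qed
qed

text \<open>With \<open>l - f\<close> held fixed, the subtracted term is a constant multiple of a
  square over a linear term, the shape needed for convexity.\<close>

lemma B0_eq: "B0 l f F = 1 - (if l - F \<le> 0 then 0 else (l - F)\<^sup>2 / (l + f) / (l - f))"
  by (simp add: B0_def power2_eq_square algebra_simps)

lemma B0_minus: "B0 l (- f) F = B0 l f F"
  by (simp add: B0_def)

text \<open>If \<open>l - f\<close> is constant, \<open>1 - B0\<close> is a convex function of
  \<open>l - F\<close> and \<open>l + f\<close>, divided by the constant \<open>p\<close>. The
  directions with \<open>l + f\<close> constant follow from evenness in \<open>f\<close>.\<close>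

lemma B0_midpoint:
  assumes d: "\<bar>f\<bar> \<le> F" "\<bar>f'\<bar> \<le> F'" and z: "\<bar>l - l'\<bar> = \<bar>f - f'\<bar>"
  shows "(B0 l f F + B0 l' f' F') / 2 \<le> B0 ((l + l') / 2) ((f + f') / 2) ((F + F') / 2)"
proof -
  have *: "(B0 l f F + B0 l' f' F') / 2 \<le> B0 ((l + l') / 2) ((f + f') / 2) ((F + F') / 2)"
    if d: "\<bar>f\<bar> \<le> F" "\<bar>f'\<bar> \<le> F'" and z: "l - f = l' - f'" for f f'
  proof -
    define p where "p = l - f"
    define h where "h = (\<lambda>a q::real. if a \<le> 0 then 0 else a\<^sup>2 / q)"
    have B: "B0 l f F = 1 - h (l - F) (l + f) / p" "B0 l' f' F' = 1 - h (l' - F') (l' + f') / p"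
      using z by (simp_all add: B0_eq h_def p_def)
    have pm: "(l + l') / 2 - (f + f') / 2 = p" using z by (simp add: p_def field_simps)
    have Bm: "B0 ((l + l') / 2) ((f + f') / 2) ((F + F') / 2)
        = 1 - h ((l - F + (l' - F')) / 2) ((l + f + (l' + f')) / 2) / p"
    proof -
      have "(l + l') / 2 - (F + F') / 2 = (l - F + (l' - F')) / 2"
        "(l + l') / 2 + (f + f') / 2 = (l + f + (l' + f')) / 2" by (simp_all add: field_simps)
      thus ?thesis by (simp only: B0_eq pm h_def) simp
    qed
    have nonneg: "0 \<le> h (l - F) (l + f) / p" "0 \<le> h (l' - F') (l' + f') / p"
      using d z by (auto simp: h_def p_def zero_le_divide_iff)
    show ?thesis
    proof (cases "l - F + (l' - F') \<le> 0")
      \<comment> \<open>At the midpoint \<open>B0\<close> is 1, and both subtracted terms are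
        nonnegative.\<close>
      case True
      thus ?thesis using nonneg unfolding B Bm by (simp add: h_def)
    next
      case False
      hence p: "p > 0" using d z by (auto simp: p_def)
      \<comment> \<open>\<open>h\<close> is homogeneous of degree one, so subadditivity gives the
        midpoint inequality.\<close>
      have "h ((l - F + (l' - F')) / 2) ((l + f + (l' + f')) / 2)
          = (l - F + (l' - F'))\<^sup>2 / (l + f + (l' + f')) / 2"
      proof -
        have "((l - F + (l' - F')) / 2)\<^sup>2 / (x / 2) = (l - F + (l' - F'))\<^sup>2 / x / 2" for x
          by (simp add: power2_eq_square)
        thus ?thesis using False by (simp add: h_def del: times_divide_eq_left)
      qed
      also have "\<dots> \<le> (h (l - F) (l + f) + h (l' - F') (l' + f')) / 2"
        unfolding h_def using False d by (intro divide_right_mono square_over_linear_midpoint) auto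
      finally have "h ((l - F + (l' - F')) / 2) ((l + f + (l' + f')) / 2) / p
          \<le> (h (l - F) (l + f) + h (l' - F') (l' + f')) / 2 / p"
        using p by (intro divide_right_mono) auto
      thus ?thesis unfolding B Bm by (simp add: add_divide_distrib)
    qed
  qed
  show ?thesis
  proof (cases "l - f = l' - f'")
    case True
    thus ?thesis using *[OF d] by simp
  next
    case False
    hence "l - - f = l' - - f'" using z by (auto simp: abs_if split: if_splits)
    moreover have "(- f + - f') / 2 = - ((f + f') / 2)" by (simp add: field_simps)
    ultimately show ?thesis using *[of "- f" "- f'"] d by (simp only: B0_minus abs_minus_cancel)
  qed
qed

lemma B0_nonneg:
  assumes "\<bar>f\<bar> \<le> F"
  shows "0 \<le> B0 l f F"
proof (cases "l \<le> F")
  case False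
  have "(l - F) * (l - F) \<le> (l + f) * (l - f)" using assms False by (intro mult_mono) auto
  hence "(l - F)\<^sup>2 / ((l + f) * (l - f)) \<le> 1"
    using assms False by (auto simp: power2_eq_square divide_le_eq_1)
  thus ?thesis using False by (simp add: B0_eq)
qed (simp add: B0_def)

text \<open>A limit of at least \<open>l\<close> only keeps partial sums eventually above each
  smaller level, so the bound is needed along levels increasing to \<open>l\<close>.\<close>

lemma B0_tendsto_from_below:
  assumes "\<bar>f\<bar> \<le> F" "F < l"
  shows "((\<lambda>k. B0 (l - inverse (real (Suc k))) f F) \<longlongrightarrow> B0 l f F) sequentially"
proof -
  have lim: "(\<lambda>k. l - inverse (real (Suc k))) \<longlonglongrightarrow> l"
    using tendsto_diff[OF tendsto_const LIMSEQ_inverse_real_of_nat] by simp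
  have "l\<^sup>2 - f\<^sup>2 \<noteq> 0" using assms abs_le_square_iff[of l f] by auto
  hence "(\<lambda>k. 1 - (l - inverse (real (Suc k)) - F)\<^sup>2 / ((l - inverse (real (Suc k)))\<^sup>2 - f\<^sup>2))
      \<longlonglongrightarrow> 1 - (l - F)\<^sup>2 / (l\<^sup>2 - f\<^sup>2)"
    by (intro tendsto_intros lim)
  moreover have "\<forall>\<^sub>F k in sequentially. F < l - inverse (real (Suc k))"
    using order_tendstoD(1)[OF lim assms(2)] .
  ultimately show ?thesis
    using assms by (auto simp: B0_def elim!: Lim_transform_eventually eventually_mono)
qed

subsection \<open>Self-similarity of the Haar sum\<close>

text \<open>For \<open>c = 0\<close> and \<open>c = 1\<close> these are the contractions of the unit
  interval onto its left and right halves; composing \<open>\<phi>\<close> with them rescales its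
  restriction to a half.\<close>

definition half :: "real \<Rightarrow> real \<Rightarrow> real" where
  "half c x = (x + c) / 2"

text \<open>The dyadic subintervals of the unit interval of length greater than \<open>2 ^ (- n)\<close>, so that
  \<open>dyadic_upto n\<close> is \<open>grid (Suc n)\<close>.\<close>

fun grid :: "nat \<Rightarrow> real set set" where
  "grid 0 = {}"
| "grid (Suc n) = insert {0..<1} ((`) (half 0) ` grid n \<union> (`) (half 1) ` grid n)"

definition dyadic_cell :: "nat \<Rightarrow> nat \<Rightarrow> real set" where
  "dyadic_cell j k = {real k / 2 ^ j ..< (real k + 1) / 2 ^ j}"

lemma inj_half: "inj (half c)"
  by (auto simp: inj_def half_def)

lemma vimage_half_image [simp]: "half c -` (half c ` I) = I"
  by (rule inj_vimage_image_eq[OF inj_half])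

lemma half_image_atLeastLessThan: "half c ` {a..<b} = {half c a ..< half c b}"
proof -
  have "x \<in> half c ` {a..<b}" if "half c a \<le> x" "x < half c b" for x
    using that by (intro image_eqI[of _ _ "2 * x - c"]) (auto simp: half_def field_simps)
  thus ?thesis by (auto simp: half_def)
qed

lemma half_0_image_dyadic_cell: "half 0 ` dyadic_cell j k = dyadic_cell (Suc j) k"
  unfolding dyadic_cell_def half_image_atLeastLessThan by (simp add: half_def mult.commute)

lemma half_1_image_dyadic_cell: "half 1 ` dyadic_cell j k = dyadic_cell (Suc j) (2 ^ j + k)"
  unfolding dyadic_cell_def half_image_atLeastLessThan by (simp add: half_def field_simps)

text \<open>The recursive form suits induction on scales, the indexed form comparison with
  \<open>dyadic_upto\<close>. A cell of level \<open>i + 1\<close> comes from the left half for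
  indices below \<open>2 ^ i\<close>, and otherwise from the right half with its index lowered by
  \<open>2 ^ i\<close>.\<close>

lemma grid_eq: "grid n = {dyadic_cell j k | j k. j < n \<and> k < 2 ^ j}"
proof (induction n)
  case (Suc n)
  show ?case (is "_ = ?R")
  proof (intro equalityI subsetI)
    fix I assume "I \<in> grid (Suc n)"
    then consider "I = {0..<1}" | c j k where "c \<in> {0, 1}" "I = half c ` dyadic_cell j k" "j < n" "k < 2 ^ j"
      using Suc.IH by auto
    thus "I \<in> ?R"
    proof cases
      case 1
      hence "I = dyadic_cell 0 0" by (simp add: dyadic_cell_def)
      thus ?thesis by fastforce
    next
      case 2
      hence "I = dyadic_cell (Suc j) k \<or> I = dyadic_cell (Suc j) (2 ^ j + k)"
        using half_0_image_dyadic_cell half_1_image_dyadic_cell by (metis insertE singletonD)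
      moreover have "k < 2 ^ Suc j" "2 ^ j + k < 2 ^ Suc j" "Suc j < Suc n" using 2 by simp_all
      ultimately show ?thesis by blast
    qed
  next
    fix I assume "I \<in> ?R"
    then obtain j k where I: "I = dyadic_cell j k" "j < Suc n" "k < 2 ^ j" by blast
    show "I \<in> grid (Suc n)"
    proof (cases j)
      case 0
      thus ?thesis using I by (simp add: dyadic_cell_def)
    next
      case (Suc i)
      show ?thesis
      proof (cases "k < 2 ^ i")
        case True
        moreover have "i < n" using I Suc by simp
        ultimately have "dyadic_cell i k \<in> grid n" unfolding Suc.IH by blast
        thus ?thesis using I Suc by (auto simp flip: half_0_image_dyadic_cell)
      next
        case False
        hence "k - 2 ^ i < 2 ^ i" "i < n" using I Suc by auto
        hence "dyadic_cell i (k - 2 ^ i) \<in> grid n" unfolding Suc.IH by blast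
        moreover have "I = half 1 ` dyadic_cell i (k - 2 ^ i)"
          using I Suc False by (simp add: half_1_image_dyadic_cell)
        ultimately show ?thesis by auto
      qed
    qed
  qed
qed auto

lemma dyadic_cell_in_dyadic_intervals: "dyadic_cell j k \<in> dyadic_intervals"
proof -
  have "dyadic_cell j k
      = {of_int (int k) * 2 powi (- int j) ..< (of_int (int k) + 1) * 2 powi (- int j)}"
    by (simp add: dyadic_cell_def power_int_minus field_simps)
  thus ?thesis unfolding dyadic_intervals_def by blast
qed

lemma leb_dyadic_cell: "leb (dyadic_cell j k) = 1 / 2 ^ j"
  by (simp add: dyadic_cell_def divide_right_mono flip: diff_divide_distrib)

lemma dyadic_cell_subset:
  assumes "k < 2 ^ j"
  shows "dyadic_cell j k \<subseteq> {0..<1}"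
proof -
  have "Suc k \<le> 2 ^ j" using assms by simp
  hence "real (Suc k) \<le> 2 ^ j" by (metis of_nat_le_iff of_nat_numeral of_nat_power)
  hence "(real k + 1) / 2 ^ j \<le> 1" by (simp add: field_simps)
  moreover have "0 \<le> real k / 2 ^ j" by simp
  ultimately show ?thesis unfolding dyadic_cell_def by (meson atLeastLessThan_iff order_trans less_le_trans subsetI)
qed

lemma dyadic_subinterval_is_cell:
  assumes "I \<in> dyadic_intervals" "I \<subseteq> I0"
  obtains j k where "I = dyadic_cell j k" "k < 2 ^ j"
proof -
  obtain j k :: int where I: "I = {of_int k * 2 powi (- j) ..< (of_int k + 1) * 2 powi (- j)}"
    using assms by (auto simp: dyadic_intervals_def)
  define d :: real where "d = 2 powi (- j)"
  have d: "d > 0" by (simp add: d_def)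
  have Id: "I = {of_int k * d ..< (of_int k + 1) * d}" by (simp add: I d_def)
  have less: "of_int k * d < (of_int k + 1) * d" using d by simp
  \<comment> \<open>Passing to the closure turns inclusion of a half-open interval into inequalities
    for both endpoints.\<close>
  have "closure {of_int k * d ..< (of_int k + 1) * d} \<subseteq> {0..1}"
    using assms(2) unfolding Id I0_def by (rule closure_minimal) simp
  hence lo: "0 \<le> of_int k * d" and hi: "(of_int k + 1) * d \<le> 1" using less by simp_all
  have k: "k \<ge> 0" using lo d by (simp add: zero_le_mult_iff)
  have "d \<le> (of_int k + 1) * d" using d k by simp
  hence "d \<le> 1" using hi by linarith
  have j: "j \<ge> 0"
  proof (rule ccontr)
    assume "\<not> j \<ge> 0"
    hence "d > 1" unfolding d_def by (intro one_less_power_int) auto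
    thus False using \<open>d \<le> 1\<close> by simp
  qed
  have deq: "d = 1 / 2 ^ nat j"
    using j by (simp add: d_def power_int_minus power_int_nonneg_exp inverse_eq_divide)
  have "real_of_int (k + 1) \<le> 2 ^ nat j" using hi by (simp add: deq field_simps)
  hence "k + 1 \<le> 2 ^ nat j" using of_int_le_iff[of "k + 1" "2 ^ nat j", where ?'a = real] by simp
  hence "int (nat k) < int (2 ^ nat j)" using k by simp
  hence "nat k < 2 ^ nat j" by (simp only: of_nat_less_iff)
  moreover have "I = dyadic_cell (nat j) (nat k)"
    using k unfolding Id dyadic_cell_def deq by (simp add: field_simps)
  ultimately show thesis using that by blast
qed

lemma dyadic_upto_eq_grid: "dyadic_upto n = grid (Suc n)"
proof (intro equalityI subsetI)
  fix I assume I: "I \<in> dyadic_upto n"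
  then obtain j k where jk: "I = dyadic_cell j k" "k < 2 ^ j"
    by (auto simp: dyadic_upto_def elim: dyadic_subinterval_is_cell)
  have "1 / 2 ^ n \<le> (1 / 2 ^ j :: real)" using I by (simp add: dyadic_upto_def jk leb_dyadic_cell)
  hence "j < Suc n" by (simp add: field_simps)
  thus "I \<in> grid (Suc n)" unfolding grid_eq using jk by blast
next
  fix I assume "I \<in> grid (Suc n)"
  then obtain j k where jk: "I = dyadic_cell j k" "j < Suc n" "k < 2 ^ j" unfolding grid_eq by blast
  have "(1::real) / 2 ^ n \<le> 1 / 2 ^ j" using jk by (simp add: field_simps)
  moreover have "I \<subseteq> I0" using dyadic_cell_subset[OF jk(3)] by (auto simp: jk(1) I0_def)
  ultimately show "I \<in> dyadic_upto n"
    by (simp add: dyadic_upto_def jk leb_dyadic_cell dyadic_cell_in_dyadic_intervals)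
qed

lemma signs_iff: "\<epsilon> \<in> signs \<longleftrightarrow> (\<forall>n. \<forall>I\<in>grid n. \<epsilon> I \<in> {-1, 1})"
proof
  assume \<epsilon>: "\<epsilon> \<in> signs"
  show "\<forall>n. \<forall>I\<in>grid n. \<epsilon> I \<in> {-1, 1}"
  proof (intro allI ballI)
    fix n I assume "I \<in> grid n"
    hence "I \<in> dyadic_upto n" unfolding dyadic_upto_eq_grid grid_eq by fastforce
    thus "\<epsilon> I \<in> {-1, 1}" using \<epsilon> by (auto simp: signs_def dyadic_upto_def)
  qed
next
  assume *: "\<forall>n. \<forall>I\<in>grid n. \<epsilon> I \<in> {-1, 1}"
  have "\<epsilon> I \<in> {-1, 1}" if I: "I \<in> dyadic_intervals" "I \<subseteq> I0" for I
  proof -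
    obtain j k where "I = dyadic_cell j k" "k < 2 ^ j" using dyadic_subinterval_is_cell[OF I] .
    hence "I \<in> grid (Suc j)" unfolding grid_eq by blast
    thus ?thesis using * by blast
  qed
  thus "\<epsilon> \<in> signs" by (simp add: signs_def)
qed

lemma finite_grid: "finite (grid n)"
  by (induction n) auto

lemma grid_interval:
  assumes "I \<in> grid n"
  obtains a b where "I = {a..<b}" "0 \<le> a" "a < b" "b \<le> 1"
proof -
  obtain j k where I: "I = dyadic_cell j k" "k < 2 ^ j" using assms unfolding grid_eq by blast
  have less: "real k / 2 ^ j < (real k + 1) / 2 ^ j" by (simp add: divide_strict_right_mono)
  moreover have "closure {real k / 2 ^ j ..< (real k + 1) / 2 ^ j} \<subseteq> {0..1}"
    using dyadic_cell_subset[OF I(2)] by (intro closure_minimal) (auto simp: dyadic_cell_def subset_iff less_imp_le)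
  hence "0 \<le> real k / 2 ^ j" "(real k + 1) / 2 ^ j \<le> 1" using less by simp_all
  ultimately show thesis using that I unfolding dyadic_cell_def by blast
qed

text \<open>Indexed by the number of scales, so that induction starts from the empty sum; the given
  partial sums are these shifted by one.\<close>

definition haar_sum :: "(real set \<Rightarrow> real) \<Rightarrow> (real \<Rightarrow> real) \<Rightarrow> nat \<Rightarrow> real \<Rightarrow> real" where
  "haar_sum \<epsilon> \<phi> n x = (\<Sum>I\<in>grid n. \<epsilon> I * haar_coeff \<phi> I * haar I x)"

lemma haar_partial_sum_eq: "haar_partial_sum \<epsilon> \<phi> n = haar_sum \<epsilon> \<phi> (Suc n)"
  by (rule ext) (simp only: haar_partial_sum_def haar_sum_def dyadic_upto_eq_grid)

lemma haar_atLeastLessThan: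
  assumes "a < b"
  shows "haar {a..<b} x = (if x \<in> {(a + b) / 2..<b} then (b - a) powr (- 1 / 2)
    else if x \<in> {a..<(a + b) / 2} then - ((b - a) powr (- 1 / 2)) else 0)"
  using assms by (simp add: haar_def right_half_def left_half_def)

lemma haar_outside:
  assumes "a < b" "x \<notin> {a..<b}"
  shows "haar {a..<b} x = 0"
  using assms by (auto simp: haar_atLeastLessThan field_simps)

lemma haar_half:
  assumes "a < b"
  shows "2 powr (- 1 / 2) * haar (half c ` {a..<b}) (half c x) = haar {a..<b} x"
proof -
  have "(half c b - half c a) powr (- 1 / 2) = (b - a) powr (- 1 / 2) / 2 powr (- 1 / 2)"
  proof -
    have "half c b - half c a = (b - a) / 2" by (simp add: half_def field_simps)
    thus ?thesis using assms by (simp only: powr_divide)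
  qed
  moreover have "half c a < half c b" using assms by (simp add: half_def)
  moreover have "half c x \<in> {half c a..<half c b} \<longleftrightarrow> x \<in> {a..<b}" for a b
    by (auto simp: half_def)
  moreover have "(half c a + half c b) / 2 = half c ((a + b) / 2)" by (simp add: half_def field_simps)
  ultimately show ?thesis
    unfolding half_image_atLeastLessThan using assms
    by (simp only: haar_atLeastLessThan) simp
qed

lemma lebesgue_integral_half:
  fixes g :: "real \<Rightarrow> real"
  shows "(LINT x|lebesgue. g x) = (LINT x|lebesgue. g (half c x)) / 2"
  using lebesgue_integral_real_affine[of "1/2" g "c/2"] by (simp add: half_def add_divide_distrib add.commute)

lemma integrable_half_iff:
  fixes g :: "real \<Rightarrow> real"
  shows "integrable lebesgue (\<lambda>x. g (half c x)) \<longleftrightarrow> integrable lebesgue g"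
  using lebesgue_integrable_real_affine_iff[of "1/2" g "c/2"] by (simp add: half_def add_divide_distrib add.commute)

text \<open>The change of variables contributes 1/2 and the Haar normalisation the square root of 2.
  The remaining factor \<open>2 powr (- 1 / 2)\<close> cancels against \<open>haar_half\<close> in
  each term of the Haar sum.\<close>

lemma haar_coeff_half:
  assumes ab: "0 \<le> a" "a < b" "b \<le> 1" and c: "c \<in> {0, 1}"
  shows "haar_coeff \<phi> (half c ` {a..<b}) = 2 powr (- 1 / 2) * haar_coeff (\<phi> \<circ> half c) {a..<b}"
proof -
  define r :: real where "r = 2 powr (- 1 / 2)"
  have r: "r * r = 1 / 2" "r > 0" unfolding r_def by (simp_all add: powr_minus_divide flip: powr_add)
  have h: "haar (half c ` {a..<b}) (half c x) = haar {a..<b} x / r" for x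
    using haar_half[OF ab(2), of c x] r by (simp add: r_def field_simps)
  have "haar_coeff \<phi> (half c ` {a..<b})
      = (LINT x|lebesgue. indicator I0 (half c x) * (\<phi> (half c x) * (haar {a..<b} x / r))) / 2"
    unfolding haar_coeff_def set_lebesgue_integral_def
    by (subst lebesgue_integral_half[of _ c]) (simp add: h)
  also have "(\<lambda>x. indicator I0 (half c x) * (\<phi> (half c x) * (haar {a..<b} x / r)))
      = (\<lambda>x. indicator I0 x * ((\<phi> \<circ> half c) x * haar {a..<b} x) / r)"
  proof
    fix x
    show "indicator I0 (half c x) * (\<phi> (half c x) * (haar {a..<b} x / r))
        = indicator I0 x * ((\<phi> \<circ> half c) x * haar {a..<b} x) / r"
    \<comment> \<open>On the support of the Haar function both \<open>x\<close> and
      \<open>half c x\<close> lie in \<open>I0\<close>, so the two indicators agree.\<close>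
    proof (cases "x \<in> {a..<b}")
      case True
      hence "x \<in> I0" "half c x \<in> I0" using ab c by (auto simp: I0_def half_def)
      thus ?thesis by simp
    qed (simp add: haar_outside[OF ab(2)])
  qed
  also have "(LINT x|lebesgue. indicator I0 x * ((\<phi> \<circ> half c) x * haar {a..<b} x) / r) / 2
      = haar_coeff (\<phi> \<circ> half c) {a..<b} / r / 2"
    by (simp add: haar_coeff_def set_lebesgue_integral_def)
  also have "\<dots> = r * haar_coeff (\<phi> \<circ> half c) {a..<b}"
  proof -
    have "1 / r / 2 = r" using r by (simp add: field_simps)
    thus ?thesis by (metis mult.commute mult.right_neutral times_divide_eq_left times_divide_eq_right)
  qed
  finally show ?thesis by (simp add: r_def)
qed

lemma haar_unit: "haar {0..<1} x = (if x \<in> {1/2..<1} then 1 else if x \<in> {0..<1/2} then -1 else 0)"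
  by (simp add: haar_atLeastLessThan)

text \<open>The top Haar function is constant on each half, with sign \<open>2 * c - 1\<close>.
  Terms from the opposite half vanish at \<open>half c x\<close>; those from the same half form the
  rescaled sum with one scale less.\<close>

lemma haar_sum_half:
  assumes c: "c \<in> {0, 1}" and x: "x \<in> {0..<1}"
  shows "haar_sum \<epsilon> \<phi> (Suc n) (half c x)
    = (2 * c - 1) * \<epsilon> {0..<1} * haar_coeff \<phi> {0..<1} + haar_sum (\<epsilon> \<circ> (`) (half c)) (\<phi> \<circ> half c) n x"
proof -
  let ?g = "\<lambda>I. \<epsilon> I * haar_coeff \<phi> I * haar I (half c x)"
  have sub: "I \<subseteq> {0..<1}" "I \<noteq> {}" if I: "I \<in> grid n" for I
  proof -
    obtain a b where "I = {a..<b}" "0 \<le> a" "a < b" "b \<le> 1" using grid_interval[OF I] .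
    thus "I \<subseteq> {0..<1}" "I \<noteq> {}" by (auto intro: less_le_trans)
  qed
  have img: "half d ` I \<subseteq> {d / 2..<(d + 1) / 2}" if "I \<in> grid n" for I d
    using sub(1)[OF that] by (auto simp: half_def subset_iff)
  have zero: "?g I = 0" if I: "I \<in> (`) (half (1 - c)) ` grid n" for I
  proof -
    obtain J where J: "J \<in> grid n" "I = half (1 - c) ` J" using I by auto
    then obtain a b where ab: "J = {a..<b}" "a < b" by (auto elim: grid_interval)
    have "half c x \<notin> I" using img[OF J(1), of "1 - c"] c x by (auto simp: J(2) half_def)
    moreover have "half (1 - c) a < half (1 - c) b" using ab by (simp add: half_def)
    ultimately show ?thesis by (simp add: J ab half_image_atLeastLessThan haar_outside)
  qed
  have inner: "(\<Sum>I\<in>(`) (half c) ` grid n. ?g I) = haar_sum (\<epsilon> \<circ> (`) (half c)) (\<phi> \<circ> half c) n x"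
  proof -
    have "inj_on ((`) (half c)) (grid n)" by (meson inj_half inj_image_eq_iff inj_onI)
    hence "(\<Sum>I\<in>(`) (half c) ` grid n. ?g I) = (\<Sum>I\<in>grid n. ?g (half c ` I))"
      by (simp add: sum.reindex)
    also have "\<dots> = haar_sum (\<epsilon> \<circ> (`) (half c)) (\<phi> \<circ> half c) n x"
      unfolding haar_sum_def
    proof (rule sum.cong)
      fix I assume "I \<in> grid n"
      then obtain a b where ab: "I = {a..<b}" "0 \<le> a" "a < b" "b \<le> 1" by (rule grid_interval)
      show "?g (half c ` I) = (\<epsilon> \<circ> (`) (half c)) I * haar_coeff (\<phi> \<circ> half c) I * haar I x"
        using haar_half[OF ab(3), of c x] haar_coeff_half[OF ab(2-4) c, of \<phi>]
        by (simp add: ab(1) mult_ac flip: \<open>_ = haar {a..<b} x\<close>)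
    qed simp
    finally show ?thesis .
  qed
  \<comment> \<open>Disjointness here, and the top interval being separate below, let the sum split
    with no interval counted twice.\<close>
  have "(`) (half 0) ` grid n \<inter> (`) (half 1) ` grid n = {}"
  proof -
    have False if *: "I \<in> grid n" "J \<in> grid n" "half 0 ` I = half 1 ` J" for I J
    proof -
      obtain y where "y \<in> I" using sub(2)[OF *(1)] by auto
      hence "half 0 y \<in> half 0 ` I" by simp
      moreover have "half 0 ` I \<subseteq> {0..<1/2}" "half 0 ` I \<subseteq> {1/2..<1}"
        using img[OF *(1), of 0] img[OF *(2), of 1] *(3) by simp_all
      ultimately show False by (meson atLeastLessThan_iff not_le subsetD)
    qed
    thus ?thesis by blast
  qed
  moreover have "{0..<1} \<notin> (`) (half d) ` grid n" if "d \<in> {0, 1}" for d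
  proof
    assume "{0..<1} \<in> (`) (half d) ` grid n"
    then obtain I where "I \<in> grid n" "{0..<1} = half d ` I" by blast
    hence "{0..<1} \<subseteq> {d / 2..<(d + 1) / 2}" using img by metis
    thus False using that by auto
  qed
  ultimately have "haar_sum \<epsilon> \<phi> (Suc n) (half c x)
      = ?g {0..<1} + ((\<Sum>I\<in>(`) (half 0) ` grid n. ?g I) + (\<Sum>I\<in>(`) (half 1) ` grid n. ?g I))"
    unfolding haar_sum_def by (simp add: finite_grid sum.union_disjoint)
  also have "(\<Sum>I\<in>(`) (half 0) ` grid n. ?g I) + (\<Sum>I\<in>(`) (half 1) ` grid n. ?g I)
      = haar_sum (\<epsilon> \<circ> (`) (half c)) (\<phi> \<circ> half c) n x"
  proof -
    have "(\<Sum>I\<in>(`) (half (1 - c)) ` grid n. ?g I) = 0" using zero by (intro sum.neutral) blast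
    thus ?thesis using inner c by auto
  qed
  also have "haar {0..<1} (half c x) = 2 * c - 1"
    using c x by (auto simp: haar_unit half_def)
  finally show ?thesis by (simp only: mult.commute mult.left_commute)
qed

subsection \<open>Integrals and measures over the halves\<close>

text \<open>Taken over the half-open interval, whose halves are again of this kind; it agrees with
  the average over \<open>I0\<close> because one endpoint is a null set.\<close>

definition mean :: "(real \<Rightarrow> real) \<Rightarrow> real" where
  "mean \<phi> = (LINT x:{0..<1}|lebesgue. \<phi> x)"

lemma indicator_I0_eq: "indicator I0 x * \<phi> x = indicator {0..<1} x * \<phi> x + indicator {1} x * \<phi> 1"
  for \<phi> :: "real \<Rightarrow> real"
  by (auto simp: indicator_def I0_def)

lemma integrable_indicator_singleton: "integrable lebesgue (\<lambda>x::real. indicator {1} x * (c::real))"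
  by (intro integrable_mult_left integrable_real_indicator) auto

lemma set_integrable_I0_iff:
  fixes \<phi> :: "real \<Rightarrow> real"
  shows "set_integrable lebesgue I0 \<phi> \<longleftrightarrow> set_integrable lebesgue {0..<1} \<phi>"
proof
  assume "set_integrable lebesgue I0 \<phi>"
  thus "set_integrable lebesgue {0..<1} \<phi>"
    by (rule set_integrable_subset) (auto simp: I0_def)
next
  assume "set_integrable lebesgue {0..<1} \<phi>"
  thus "set_integrable lebesgue I0 \<phi>"
    using integrable_indicator_singleton[of "\<phi> 1"] unfolding set_integrable_def
    by (simp add: indicator_I0_eq)
qed

lemma average_I0:
  assumes "set_integrable lebesgue I0 \<phi>"
  shows "average \<phi> I0 = mean \<phi>"
proof -
  have "(LINT x|lebesgue. indicator {0..<1} x * \<phi> x + indicator {1} x * \<phi> 1)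
      = (LINT x|lebesgue. indicator {0..<1} x * \<phi> x) + (LINT x|lebesgue. indicator {1} x * \<phi> 1)"
    using assms[unfolded set_integrable_I0_iff] integrable_indicator_singleton
    unfolding set_integrable_def real_scaleR_def by (subst Bochner_Integration.integral_add) simp_all
  moreover have "leb I0 = 1" by (simp add: I0_def)
  ultimately show ?thesis
    unfolding average_def mean_def set_lebesgue_integral_def real_scaleR_def indicator_I0_eq by simp
qed

lemma set_integrable_half:
  fixes \<phi> :: "real \<Rightarrow> real"
  assumes \<phi>: "set_integrable lebesgue {0..<1} \<phi>" and c: "c \<in> {0, 1}"
  shows "set_integrable lebesgue {0..<1} (\<phi> \<circ> half c)"
proof -
  have "set_integrable lebesgue (half c ` {0..<1}) \<phi>"
    using c by (intro set_integrable_subset[OF \<phi>])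
      (auto simp only: half_image_atLeastLessThan, auto simp: half_def)
  hence "integrable lebesgue (\<lambda>x. indicator (half c ` {0..<1}) (half c x) * \<phi> (half c x))"
    by (simp add: set_integrable_def integrable_half_iff[of "\<lambda>x. indicator (half c ` {0..<1}) x * \<phi> x"])
  thus ?thesis
    by (simp add: set_integrable_def indicator_def inj_image_mem_iff[OF inj_half])
qed

text \<open>The weights let one computation serve both the mean, with weights 1 and 1, and the top
  Haar coefficient, with weights -1 and 1.\<close>

lemma integral_halves:
  assumes \<phi>: "set_integrable lebesgue {0..<1} \<phi>"
    and h: "\<And>x. h x = w0 * indicator {0..<1/2} x * \<phi> x + w1 * indicator {1/2..<1} x * \<phi> x"
  shows "(LINT x|lebesgue. h x) = (w0 * mean (\<phi> \<circ> half 0) + w1 * mean (\<phi> \<circ> half 1)) / 2"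
proof -
  have int: "integrable lebesgue (\<lambda>x. w * (indicator {c/2..<(c+1)/2} x * \<phi> x))" if "c \<in> {0, 1}" for w c
    using set_integrable_subset[OF \<phi>, of "{c/2..<(c+1)/2}"] that
    by (auto simp: set_integrable_def)
  have val: "(LINT x|lebesgue. indicator {c/2..<(c+1)/2} x * \<phi> x) = mean (\<phi> \<circ> half c) / 2" for c
  proof -
    have "(LINT x|lebesgue. indicator {c/2..<(c+1)/2} x * \<phi> x)
        = (LINT x|lebesgue. indicator {c/2..<(c+1)/2} (half c x) * \<phi> (half c x)) / 2"
      by (rule lebesgue_integral_half)
    also have "(\<lambda>x. indicator {c/2..<(c+1)/2} (half c x) * \<phi> (half c x))
        = (\<lambda>x. indicator {0..<1} x * \<phi> (half c x))"
      by (auto simp: half_def indicator_def)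
    finally show ?thesis by (simp add: mean_def set_lebesgue_integral_def)
  qed
  have "(LINT x|lebesgue. h x)
      = (LINT x|lebesgue. w0 * (indicator {0..<1/2} x * \<phi> x) + w1 * (indicator {1/2..<1} x * \<phi> x))"
    by (simp add: h mult_ac)
  also have "\<dots> = w0 * (LINT x|lebesgue. indicator {0..<1/2} x * \<phi> x)
      + w1 * (LINT x|lebesgue. indicator {1/2..<1} x * \<phi> x)"
    using int[of 0 w0] int[of 1 w1] by (subst Bochner_Integration.integral_add) simp_all
  also have "\<dots> = w0 * (mean (\<phi> \<circ> half 0) / 2) + w1 * (mean (\<phi> \<circ> half 1) / 2)"
    using val[of 0] val[of 1] by (simp only: add_0 div_0 one_add_one divide_self_if) simp
  finally show ?thesis by (simp add: add_divide_distrib)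
qed

lemma mean_halves:
  assumes "set_integrable lebesgue {0..<1} \<phi>"
  shows "mean \<phi> = (mean (\<phi> \<circ> half 0) + mean (\<phi> \<circ> half 1)) / 2"
proof -
  have "mean \<phi> = (1 * mean (\<phi> \<circ> half 0) + 1 * mean (\<phi> \<circ> half 1)) / 2"
    unfolding mean_def[of \<phi>] set_lebesgue_integral_def
    by (rule integral_halves[OF assms]) (auto simp: indicator_def)
  thus ?thesis by simp
qed

lemma haar_coeff_unit:
  assumes "set_integrable lebesgue {0..<1} \<phi>"
  shows "haar_coeff \<phi> {0..<1} = (mean (\<phi> \<circ> half 1) - mean (\<phi> \<circ> half 0)) / 2"
proof -
  have "haar_coeff \<phi> {0..<1} = (-1 * mean (\<phi> \<circ> half 0) + 1 * mean (\<phi> \<circ> half 1)) / 2"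
    unfolding haar_coeff_def set_lebesgue_integral_def
    by (rule integral_halves[OF assms]) (auto simp: indicator_def haar_unit I0_def)
  thus ?thesis by simp
qed

lemma abs_mean_le:
  assumes "set_integrable lebesgue {0..<1} \<phi>"
  shows "\<bar>mean \<phi>\<bar> \<le> mean (\<lambda>x. \<bar>\<phi> x\<bar>)"
  using integral_abs_bound[of lebesgue "\<lambda>x. indicator {0..<1} x * \<phi> x"]
  by (simp add: mean_def set_lebesgue_integral_def abs_mult)

lemma sets_lebesgue_half_image:
  assumes "A \<in> sets lebesgue"
  shows "half c ` A \<in> sets lebesgue"
proof -
  have "(\<lambda>x. - c + 2 * x) \<in> lebesgue \<rightarrow>\<^sub>M lebesgue"
    using lebesgue_affine_measurable[where c = "\<lambda>x::real. 2" and t = "- c"] by simp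
  hence "(\<lambda>x. - c + 2 * x) -` A \<inter> space lebesgue \<in> sets lebesgue"
    using assms by (rule measurable_sets)
  moreover have "(\<lambda>x. - c + 2 * x) -` A = half c ` A"
  proof (intro equalityI subsetI)
    fix x assume "x \<in> (\<lambda>x. - c + 2 * x) -` A"
    thus "x \<in> half c ` A" by (intro image_eqI[of _ _ "- c + 2 * x"]) (auto simp: half_def)
  qed (auto simp: half_def field_simps)
  ultimately show ?thesis by simp
qed

lemma leb_half_image: "leb (half c ` A) = leb A / 2"
proof -
  have "half c = (\<lambda>x. (1/2) *\<^sub>R x + c / 2)" by (auto simp: half_def add_divide_distrib)
  thus ?thesis using measure_lebesgue_affine[of "1/2" "c/2" A] by simp
qed

lemma emeasure_subset_unit_finite:
  assumes "A \<subseteq> {0..<1::real}"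
  shows "emeasure lebesgue A < \<infinity>"
proof -
  have "emeasure lebesgue A \<le> emeasure lebesgue {0..<1::real}"
    using assms by (intro emeasure_mono) auto
  thus ?thesis by (simp add: order_le_less_trans)
qed

text \<open>The set is the disjoint union of the images of its two pullbacks, and each contraction
  halves measure.\<close>

lemma leb_halves:
  assumes m: "{x \<in> {0..<1}. P (half 0 x)} \<in> sets lebesgue" "{x \<in> {0..<1}. P (half 1 x)} \<in> sets lebesgue"
  shows "leb {x \<in> {0..<1}. P x}
    = (leb {x \<in> {0..<1}. P (half 0 x)} + leb {x \<in> {0..<1}. P (half 1 x)}) / 2"
proof -
  let ?A = "\<lambda>c. half c ` {x \<in> {0..<1}. P (half c x)}"
  have "{x \<in> {0..<1}. P x} = ?A 0 \<union> ?A 1"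
  proof (intro equalityI subsetI)
    fix x assume x: "x \<in> {x \<in> {0..<1}. P x}"
    define c :: real where "c = (if x < 1/2 then 0 else 1)"
    have "half c (2 * x - c) = x" by (simp add: half_def)
    moreover have "2 * x - c \<in> {0..<1}" using x by (auto simp: c_def)
    ultimately have "x \<in> ?A c" using x by (intro image_eqI[of _ _ "2 * x - c"]) auto
    thus "x \<in> ?A 0 \<union> ?A 1" by (auto simp: c_def split: if_splits)
  qed (auto simp: half_def)
  moreover have "leb (?A 0 \<union> ?A 1) = leb (?A 0) + leb (?A 1)"
  proof (rule measure_Union)
    show "?A 0 \<inter> ?A 1 = {}" by (auto simp: half_def)
    show "emeasure lebesgue (?A 0) \<noteq> \<infinity>" "emeasure lebesgue (?A 1) \<noteq> \<infinity>"
    proof -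
      have "?A 0 \<subseteq> {0..<1}" "?A 1 \<subseteq> {0..<1}" by (auto simp: half_def)
      from this[THEN emeasure_subset_unit_finite]
      show "emeasure lebesgue (?A 0) \<noteq> \<infinity>" "emeasure lebesgue (?A 1) \<noteq> \<infinity>" by simp_all
    qed
  qed (use m sets_lebesgue_half_image in auto)
  ultimately show ?thesis by (simp add: leb_half_image)
qed

section \<open>Superlevel sets of the partial sums\<close>

lemma measurable_haar [measurable]: "haar I \<in> borel_measurable lebesgue"
proof -
  have "haar I \<in> borel_measurable borel"
    unfolding haar_def right_half_def left_half_def by measurable
  thus ?thesis by (simp add: measurable_completion)
qed

lemma measurable_haar_sum [measurable]: "haar_sum \<epsilon> \<phi> n \<in> borel_measurable lebesgue"
  unfolding haar_sum_def by measurable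

lemma sets_unit_Collect:
  fixes P :: "real \<Rightarrow> bool"
  assumes "Measurable.pred lebesgue P"
  shows "{x \<in> {0..<1}. P x} \<in> sets lebesgue"
proof -
  have "{0..<1} \<inter> {x \<in> space lebesgue. P x} \<in> sets lebesgue"
    using assms unfolding pred_def by (intro sets.Int) simp_all
  also have "{0..<1} \<inter> {x \<in> space lebesgue. P x} = {x \<in> {0..<1::real}. P x}" by auto
  finally show ?thesis .
qed

lemma leb_unit_Collect_le_one: "leb {x \<in> {0..<1::real}. P x} \<le> 1"
proof -
  have "emeasure lebesgue {x \<in> {0..<1::real}. P x} \<le> emeasure lebesgue {0..<1::real}"
    by (intro emeasure_mono) auto
  thus ?thesis by (simp add: measure_def enn2real_leI)
qed

text \<open>On the two halves the top term moves the level to \<open>l + s\<close> and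
  \<open>l - s\<close>, where \<open>\<bar>s\<bar>\<close> is half the jump of the means. These data
  satisfy the slope condition of \<open>B0_midpoint\<close>, and levels and means average back to
  the original ones.\<close>

lemma leb_haar_sum_ge_le:
  assumes "\<And>I. I \<in> grid n \<Longrightarrow> \<epsilon> I \<in> {-1, 1}" and "set_integrable lebesgue {0..<1} \<phi>"
  shows "leb {x \<in> {0..<1}. l \<le> haar_sum \<epsilon> \<phi> n x} \<le> B0 l (mean \<phi>) (mean (\<lambda>x. \<bar>\<phi> x\<bar>))"
  using assms
proof (induction n arbitrary: \<epsilon> \<phi> l)
  case 0
  note dom = abs_mean_le[OF 0(2)]
  show ?case
  \<comment> \<open>The empty sum is 0: its superlevel set is everything for
    \<open>l \<le> 0\<close>, where \<open>B0\<close> is 1, and empty otherwise.\<close>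
  proof (cases "l \<le> 0")
    case True
    hence "B0 l (mean \<phi>) (mean (\<lambda>x. \<bar>\<phi> x\<bar>)) = 1" using dom by (simp add: B0_def)
    thus ?thesis using leb_unit_Collect_le_one by metis
  next
    case False
    hence "{x \<in> {0..<1}. l \<le> haar_sum \<epsilon> \<phi> 0 x} = {}" by (simp add: haar_sum_def)
    thus ?thesis using B0_nonneg[OF dom, of l] by (simp only: measure_empty)
  qed
next
  case (Suc n)
  note int = Suc.prems(2)
  define s where "s = \<epsilon> {0..<1} * haar_coeff \<phi> {0..<1}"
  have half: "leb {x \<in> {0..<1}. l \<le> haar_sum \<epsilon> \<phi> (Suc n) (half c x)}
      \<le> B0 (l - (2 * c - 1) * s) (mean (\<phi> \<circ> half c)) (mean (\<lambda>x. \<bar>(\<phi> \<circ> half c) x\<bar>))"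
    and sets: "{x \<in> {0..<1}. l \<le> haar_sum \<epsilon> \<phi> (Suc n) (half c x)} \<in> sets lebesgue"
    if c: "c \<in> {0, 1}" for c
  proof -
    have eq: "{x \<in> {0..<1}. l \<le> haar_sum \<epsilon> \<phi> (Suc n) (half c x)}
        = {x \<in> {0..<1}. l - (2 * c - 1) * s \<le> haar_sum (\<epsilon> \<circ> (`) (half c)) (\<phi> \<circ> half c) n x}"
    proof (rule Collect_cong, rule conj_cong[OF refl])
      fix x :: real assume "x \<in> {0..<1}"
      from haar_sum_half[OF c this, of \<epsilon> \<phi> n]
      have "haar_sum \<epsilon> \<phi> (Suc n) (half c x)
          = (2 * c - 1) * s + haar_sum (\<epsilon> \<circ> (`) (half c)) (\<phi> \<circ> half c) n x"
        by (simp only: s_def mult.assoc)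
      thus "(l \<le> haar_sum \<epsilon> \<phi> (Suc n) (half c x))
          = (l - (2 * c - 1) * s \<le> haar_sum (\<epsilon> \<circ> (`) (half c)) (\<phi> \<circ> half c) n x)"
        by linarith
    qed
    show "leb {x \<in> {0..<1}. l \<le> haar_sum \<epsilon> \<phi> (Suc n) (half c x)}
      \<le> B0 (l - (2 * c - 1) * s) (mean (\<phi> \<circ> half c)) (mean (\<lambda>x. \<bar>(\<phi> \<circ> half c) x\<bar>))"
      unfolding eq using c Suc.prems(1) by (intro Suc.IH[OF _ set_integrable_half[OF int c]]) auto
    show "{x \<in> {0..<1}. l \<le> haar_sum \<epsilon> \<phi> (Suc n) (half c x)} \<in> sets lebesgue"
      unfolding eq by (intro sets_unit_Collect) measurable
  qed
  have "leb {x \<in> {0..<1}. l \<le> haar_sum \<epsilon> \<phi> (Suc n) x}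
      = (leb {x \<in> {0..<1}. l \<le> haar_sum \<epsilon> \<phi> (Suc n) (half 0 x)}
        + leb {x \<in> {0..<1}. l \<le> haar_sum \<epsilon> \<phi> (Suc n) (half 1 x)}) / 2"
    using sets by (intro leb_halves) auto
  also have "\<dots> \<le> (B0 (l + s) (mean (\<phi> \<circ> half 0)) (mean (\<lambda>x. \<bar>(\<phi> \<circ> half 0) x\<bar>))
      + B0 (l - s) (mean (\<phi> \<circ> half 1)) (mean (\<lambda>x. \<bar>(\<phi> \<circ> half 1) x\<bar>))) / 2"
    using half[of 0] half[of 1] by simp
  also have "\<dots> \<le> B0 ((l + s + (l - s)) / 2) ((mean (\<phi> \<circ> half 0) + mean (\<phi> \<circ> half 1)) / 2)
      ((mean (\<lambda>x. \<bar>(\<phi> \<circ> half 0) x\<bar>) + mean (\<lambda>x. \<bar>(\<phi> \<circ> half 1) x\<bar>)) / 2)"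
  proof (intro B0_midpoint abs_mean_le set_integrable_half int)
    have "\<bar>\<epsilon> {0..<1}\<bar> = 1" using Suc.prems(1)[of "{0..<1}"] by auto
    thus "\<bar>l + s - (l - s)\<bar> = \<bar>mean (\<phi> \<circ> half 0) - mean (\<phi> \<circ> half 1)\<bar>"
      by (simp add: s_def haar_coeff_unit[OF int] abs_mult)
  qed auto
  also have "\<dots> = B0 l (mean \<phi>) (mean (\<lambda>x. \<bar>\<phi> x\<bar>))"
    using mean_halves[OF int] mean_halves[OF set_integrable_abs[OF int]]
    by (simp only: comp_def) simp
  finally show ?case .
qed

subsection \<open>The Bellman function\<close>

text \<open>Phrased through an existing limit \<open>s\<close>, the condition is easily followed
  under adding a constant and shifting the index, as happens on the halves.\<close>

definition limit_ge :: "(real set \<Rightarrow> real) \<Rightarrow> (real \<Rightarrow> real) \<Rightarrow> real \<Rightarrow> real \<Rightarrow> bool" where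
  "limit_ge \<epsilon> \<phi> l x \<longleftrightarrow> (\<exists>s\<ge>l. (\<lambda>n. haar_sum \<epsilon> \<phi> n x) \<longlonglongrightarrow> s)"

lemma measurable_limit_ge [measurable]: "Measurable.pred lebesgue (limit_ge \<epsilon> \<phi> l)"
proof -
  have "limit_ge \<epsilon> \<phi> l
      = (\<lambda>x. Cauchy (\<lambda>n. haar_sum \<epsilon> \<phi> n x) \<and> l \<le> lim (\<lambda>n. haar_sum \<epsilon> \<phi> n x))"
    by (auto simp: fun_eq_iff limit_ge_def Cauchy_convergent_iff limI convergent_LIMSEQ_iff
      intro: convergentI)
  moreover have "Measurable.pred lebesgue (\<lambda>x. Cauchy (\<lambda>n. haar_sum \<epsilon> \<phi> n x))"
    unfolding pred_def by (rule sets_Collect_Cauchy) measurable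
  ultimately show ?thesis by (simp add: pred_intros_logic)
qed

lemma superlevel_set_eq: "superlevel_set \<epsilon> \<phi> l = {x \<in> I0. limit_ge \<epsilon> \<phi> l x}"
proof -
  have "convergent (\<lambda>n. haar_partial_sum \<epsilon> \<phi> n x) \<and> l \<le> lim (\<lambda>n. haar_partial_sum \<epsilon> \<phi> n x)
      \<longleftrightarrow> limit_ge \<epsilon> \<phi> l x" for x
    unfolding limit_ge_def haar_partial_sum_eq
    using filterlim_sequentially_Suc[of "\<lambda>n. haar_sum \<epsilon> \<phi> n x"]
    by (metis convergent_LIMSEQ_iff convergent_def limI)
  thus ?thesis by (simp add: superlevel_set_def)
qed

lemma leb_superlevel_set: "leb (superlevel_set \<epsilon> \<phi> l) = leb {x \<in> {0..<1}. limit_ge \<epsilon> \<phi> l x}"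
proof -
  have "superlevel_set \<epsilon> \<phi> l
      = {x \<in> {0..<1}. limit_ge \<epsilon> \<phi> l x} \<union> {x \<in> {1}. limit_ge \<epsilon> \<phi> l x}"
    by (auto simp: superlevel_set_eq I0_def)
  moreover have "{x \<in> {1}. limit_ge \<epsilon> \<phi> l x} \<in> null_sets lebesgue"
  proof -
    have "{x \<in> {1}. limit_ge \<epsilon> \<phi> l x} = (if limit_ge \<epsilon> \<phi> l 1 then {1} else {})" by auto
    moreover have "{1::real} \<in> null_sets lebesgue"
      by (intro null_sets_completionI) (simp add: null_sets_def)
    ultimately show ?thesis by simp
  qed
  ultimately show ?thesis
    using sets_unit_Collect[OF measurable_limit_ge] by (simp only: measure_Un_null_set)
qed

text \<open>The bound for partial sums gives the estimate at every level \<open>l' < l\<close>, and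
  \<open>l'\<close> then tends to \<open>l\<close> from below. For \<open>l\<close> at most the mean
  of \<open>\<bar>\<phi>\<bar>\<close> the bound is simply 1.\<close>

lemma leb_limit_ge_le:
  assumes \<epsilon>: "\<epsilon> \<in> signs" and int: "set_integrable lebesgue {0..<1} \<phi>"
  shows "leb {x \<in> {0..<1}. limit_ge \<epsilon> \<phi> l x} \<le> B0 l (mean \<phi>) (mean (\<lambda>x. \<bar>\<phi> x\<bar>))"
proof -
  define B where "B = (\<lambda>l. B0 l (mean \<phi>) (mean (\<lambda>x. \<bar>\<phi> x\<bar>)))"
  have below: "leb {x \<in> {0..<1}. limit_ge \<epsilon> \<phi> l x} \<le> B l'" if "l' < l" for l'
  proof -
    \<comment> \<open>These sets increase with \<open>m\<close>, and each lies in the superlevel set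
      of a single partial sum, so the union still obeys the bound at \<open>l'\<close>.\<close>
    define A where "A = (\<lambda>m. {x \<in> {0..<1}. \<forall>n\<ge>m. l' \<le> haar_sum \<epsilon> \<phi> n x})"
    have sets: "A m \<in> sets lebesgue" for m
      unfolding A_def by (intro sets_unit_Collect) measurable
    have finite: "emeasure lebesgue (\<Union>m. A m) < \<infinity>"
      by (rule emeasure_subset_unit_finite) (auto simp: A_def)
    have "{x \<in> {0..<1}. limit_ge \<epsilon> \<phi> l x} \<subseteq> (\<Union>m. A m)"
    proof
      fix x assume "x \<in> {x \<in> {0..<1}. limit_ge \<epsilon> \<phi> l x}"
      then obtain s where s: "x \<in> {0..<1}" "l \<le> s" "(\<lambda>n. haar_sum \<epsilon> \<phi> n x) \<longlonglongrightarrow> s"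
        by (auto simp: limit_ge_def)
      hence "\<forall>\<^sub>F n in sequentially. l' < haar_sum \<epsilon> \<phi> n x"
        using that by (intro order_tendstoD(1)[OF s(3)]) simp
      then obtain m where "\<forall>n\<ge>m. l' < haar_sum \<epsilon> \<phi> n x" by (auto simp: eventually_sequentially)
      thus "x \<in> (\<Union>m. A m)" using s(1) by (auto simp: A_def intro: less_imp_le)
    qed
    hence "leb {x \<in> {0..<1}. limit_ge \<epsilon> \<phi> l x} \<le> leb (\<Union>m. A m)"
    proof (rule measure_mono_fmeasurable)
      show "(\<Union>m. A m) \<in> fmeasurable lebesgue"
        using sets finite by (intro fmeasurableI sets.countable_UN) auto
    qed (intro sets_unit_Collect measurable_limit_ge)
    also have "leb (\<Union>m. A m) \<le> B l'"
    proof (rule LIMSEQ_le_const2)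
      show "(\<lambda>m. leb (A m)) \<longlonglongrightarrow> leb (\<Union>m. A m)"
        proof (rule Lim_measure_incseq)
        show "incseq A" by (auto simp: A_def incseq_def)
      qed (use sets finite in auto)
      have "leb (A m) \<le> B l'" for m
      proof -
        have "leb (A m) \<le> leb {x \<in> {0..<1}. l' \<le> haar_sum \<epsilon> \<phi> m x}"
        proof (rule measure_mono_fmeasurable)
          show "{x \<in> {0..<1}. l' \<le> haar_sum \<epsilon> \<phi> m x} \<in> fmeasurable lebesgue"
            by (intro fmeasurableI sets_unit_Collect emeasure_subset_unit_finite) auto
          show "A m \<subseteq> {x \<in> {0..<1}. l' \<le> haar_sum \<epsilon> \<phi> m x}" by (auto simp: A_def)
        qed (rule sets)
        also have "\<dots> \<le> B l'"
          using \<epsilon> int unfolding B_def signs_iff by (intro leb_haar_sum_ge_le) auto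
        finally show ?thesis .
      qed
      thus "\<exists>N. \<forall>m\<ge>N. leb (A m) \<le> B l'" by blast
    qed
    finally show ?thesis .
  qed
  show ?thesis
  proof (cases "l \<le> mean (\<lambda>x. \<bar>\<phi> x\<bar>)")
    case True
    thus ?thesis using leb_unit_Collect_le_one by (simp add: B0_def)
  next
    case False
    hence "(\<lambda>k. B (l - inverse (real (Suc k)))) \<longlonglongrightarrow> B l"
      unfolding B_def using B0_tendsto_from_below[OF abs_mean_le[OF int]] by simp
    moreover have "\<forall>k. leb {x \<in> {0..<1}. limit_ge \<epsilon> \<phi> l x} \<le> B (l - inverse (real (Suc k)))"
      using below by simp
    ultimately have "leb {x \<in> {0..<1}. limit_ge \<epsilon> \<phi> l x} \<le> B l"
      by (intro LIMSEQ_le_const) auto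
    thus ?thesis by (simp add: B_def)
  qed
qed

lemma admissible_iff:
  "\<phi> \<in> admissible f F \<longleftrightarrow>
    set_integrable lebesgue {0..<1} \<phi> \<and> mean \<phi> = f \<and> mean (\<lambda>x. \<bar>\<phi> x\<bar>) = F"
proof (cases "set_integrable lebesgue {0..<1} \<phi>")
  case True
  hence "set_integrable lebesgue I0 \<phi>" "set_integrable lebesgue I0 (\<lambda>x. \<bar>\<phi> x\<bar>)"
    using set_integrable_abs set_integrable_I0_iff by blast+
  thus ?thesis using True average_I0 by (auto simp: admissible_def)
qed (simp add: admissible_def set_integrable_I0_iff)

section \<open>Gluing functions and signs from the two halves\<close>

lemma mean_cong:
  assumes "\<And>x. x \<in> {0..<1} \<Longrightarrow> \<phi> x = \<psi> x"
  shows "mean \<phi> = mean \<psi>"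
  unfolding mean_def by (rule set_lebesgue_integral_cong) (use assms in auto)

lemma haar_sum_cong:
  assumes "\<And>I. I \<in> grid n \<Longrightarrow> \<epsilon> I = \<delta> I" and eq: "\<And>x. x \<in> {0..<1} \<Longrightarrow> \<phi> x = \<psi> x"
  shows "haar_sum \<epsilon> \<phi> n = haar_sum \<delta> \<psi> n"
proof -
  have "haar_coeff \<phi> I = haar_coeff \<psi> I" if I: "I \<in> grid n" for I
  proof -
    obtain a b where ab: "I = {a..<b}" "0 \<le> a" "a < b" "b \<le> 1" using grid_interval[OF I] .
    have "\<phi> x * haar I x = \<psi> x * haar I x" for x
      using eq[of x] ab haar_outside[OF ab(3), of x] by (cases "x \<in> {a..<b}") auto
    thus ?thesis by (simp only: haar_coeff_def)
  qed
  thus ?thesis using assms(1) unfolding haar_sum_def by (intro ext sum.cong) auto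
qed

definition glue :: "(real \<Rightarrow> real) \<Rightarrow> (real \<Rightarrow> real) \<Rightarrow> real \<Rightarrow> real" where
  "glue \<phi> \<psi> x = (if x < 1/2 then \<phi> (2 * x) else \<psi> (2 * x - 1))"

text \<open>\<open>\<sigma>\<close> is the free sign of the top interval; the preimages bring a
  dyadic interval inside a half back to unit scale, where \<open>\<epsilon>\<close> and
  \<open>\<delta>\<close> act.\<close>

definition glue_signs :: "real \<Rightarrow> (real set \<Rightarrow> real) \<Rightarrow> (real set \<Rightarrow> real) \<Rightarrow> real set \<Rightarrow> real" where
  "glue_signs \<sigma> \<epsilon> \<delta> I = (if I = {0..<1} then \<sigma> else if I \<subseteq> {0..<1/2} then \<epsilon> (half 0 -` I)
    else \<delta> (half 1 -` I))"

lemma glue_half_0: "x \<in> {0..<1} \<Longrightarrow> (glue \<phi> \<psi> \<circ> half 0) x = \<phi> x"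
  by (simp add: glue_def half_def)

lemma glue_half_1: "x \<in> {0..<1} \<Longrightarrow> (glue \<phi> \<psi> \<circ> half 1) x = \<psi> x"
  by (simp add: glue_def half_def add_divide_distrib)

lemma glue_signs_half_0:
  assumes "I \<in> grid n"
  shows "(glue_signs \<sigma> \<epsilon> \<delta> \<circ> (`) (half 0)) I = \<epsilon> I"
proof -
  obtain a b where ab: "I = {a..<b}" "0 \<le> a" "a < b" "b \<le> 1" using grid_interval[OF assms] .
  have "half 0 ` I \<subseteq> {0..<1/2}" using ab by (auto simp: half_def)
  moreover from this have "half 0 ` I \<noteq> {0..<1}" by (auto simp: subset_iff dest: spec[of _ "1/2"])
  ultimately show ?thesis by (simp add: glue_signs_def)
qed

lemma glue_signs_half_1:
  assumes "I \<in> grid n"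
  shows "(glue_signs \<sigma> \<epsilon> \<delta> \<circ> (`) (half 1)) I = \<delta> I"
proof -
  obtain a b where ab: "I = {a..<b}" "0 \<le> a" "a < b" "b \<le> 1" using grid_interval[OF assms] .
  have sub: "half 1 ` I \<subseteq> {1/2..<1}" using ab by (auto simp: half_def)
  moreover have "half 1 a \<in> half 1 ` I" using ab by simp
  ultimately have "\<not> half 1 ` I \<subseteq> {0..<1/2}"
    by (meson atLeastLessThan_iff not_le subsetD)
  moreover have "half 1 ` I \<noteq> {0..<1}"
  proof
    assume "half 1 ` I = {0..<1}"
    hence "0 \<in> half 1 ` I" by simp
    thus False using sub by auto
  qed
  ultimately show ?thesis by (simp add: glue_signs_def)
qed

lemma glue_signs_in_signs:
  assumes "\<epsilon> \<in> signs" "\<delta> \<in> signs" "\<sigma> \<in> {-1, 1}"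
  shows "glue_signs \<sigma> \<epsilon> \<delta> \<in> signs"
  unfolding signs_iff
proof (intro allI ballI)
  fix n I assume "I \<in> grid n"
  then obtain m where "I \<in> grid (Suc m)" by (cases n) auto
  then consider "I = {0..<1}" | J where "J \<in> grid m" "I = half 0 ` J"
    | J where "J \<in> grid m" "I = half 1 ` J" by auto
  thus "glue_signs \<sigma> \<epsilon> \<delta> I \<in> {-1, 1}"
  proof cases
    case 1
    thus ?thesis using assms by (simp add: glue_signs_def)
  next
    case 2
    thus ?thesis using assms(1) glue_signs_half_0[OF 2(1), of \<sigma> \<epsilon> \<delta>] by (auto simp: signs_iff)
  next
    case 3
    thus ?thesis using assms(2) glue_signs_half_1[OF 3(1), of \<sigma> \<epsilon> \<delta>] by (auto simp: signs_iff)
  qed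
qed

lemma glue_admissible:
  assumes "\<phi> \<in> admissible f F" "\<psi> \<in> admissible f' F'"
  shows "glue \<phi> \<psi> \<in> admissible ((f + f') / 2) ((F + F') / 2)"
proof -
  let ?g = "glue \<phi> \<psi>"
  note adm = assms[unfolded admissible_iff]
  \<comment> \<open>Rescaled copies of the two functions live on disjoint halves and add up to
    \<open>?g\<close> cut off to the unit interval.\<close>
  have "integrable lebesgue (\<lambda>x. indicator {0..<1} (0 + 2 * x) * \<phi> (0 + 2 * x))"
    using adm lebesgue_integrable_real_affine[of "\<lambda>x. indicator {0..<1} x * \<phi> x" 2 0]
    by (simp add: set_integrable_def)
  moreover have "integrable lebesgue (\<lambda>x. indicator {0..<1} (- 1 + 2 * x) * \<psi> (- 1 + 2 * x))"
    using adm lebesgue_integrable_real_affine[of "\<lambda>x. indicator {0..<1} x * \<psi> x" 2 "- 1"]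
    by (simp add: set_integrable_def)
  ultimately have "integrable lebesgue (\<lambda>x. indicator {0..<1} (0 + 2 * x) * \<phi> (0 + 2 * x)
      + indicator {0..<1} (- 1 + 2 * x) * \<psi> (- 1 + 2 * x))"
    by (rule Bochner_Integration.integrable_add)
  also have "(\<lambda>x. indicator {0..<1} (0 + 2 * x) * \<phi> (0 + 2 * x)
      + indicator {0..<1} (- 1 + 2 * x) * \<psi> (- 1 + 2 * x)) = (\<lambda>x. indicator {0..<1} x * ?g x)"
    by (auto simp: glue_def indicator_def)
  finally have int: "set_integrable lebesgue {0..<1} ?g" by (simp add: set_integrable_def)
  have "mean (?g \<circ> half 0) = mean \<phi>" "mean (?g \<circ> half 1) = mean \<psi>"
    by (intro mean_cong glue_half_0 glue_half_1; assumption)+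
  moreover have "mean ((\<lambda>x. \<bar>?g x\<bar>) \<circ> half 0) = mean (\<lambda>x. \<bar>\<phi> x\<bar>)"
    "mean ((\<lambda>x. \<bar>?g x\<bar>) \<circ> half 1) = mean (\<lambda>x. \<bar>\<psi> x\<bar>)"
    using glue_half_0[of _ \<phi> \<psi>] glue_half_1[of _ \<phi> \<psi>] by (auto intro!: mean_cong)
  ultimately have "mean ?g = (f + f') / 2" "mean (\<lambda>x. \<bar>?g x\<bar>) = (F + F') / 2"
    using adm unfolding mean_halves[OF int] mean_halves[OF set_integrable_abs[OF int]]
    by (simp_all only:)
  thus ?thesis using int by (simp only: admissible_iff)
qed

text \<open>The top term is constant on each half, so it moves the limit, and hence the level, by a
  fixed amount.\<close>

lemma limit_ge_glue:
  assumes c: "c \<in> {0, 1}" and x: "x \<in> {0..<1}"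
    and eq: "\<And>n. haar_sum (\<epsilon> \<circ> (`) (half c)) (\<phi> \<circ> half c) n = haar_sum \<delta> \<psi> n"
  shows "limit_ge \<epsilon> \<phi> l (half c x)
    \<longleftrightarrow> limit_ge \<delta> \<psi> (l - (2 * c - 1) * \<epsilon> {0..<1} * haar_coeff \<phi> {0..<1}) x"
proof -
  define s where "s = (2 * c - 1) * \<epsilon> {0..<1} * haar_coeff \<phi> {0..<1}"
  have "haar_sum \<epsilon> \<phi> (Suc n) (half c x) = s + haar_sum \<delta> \<psi> n x" for n
    by (simp only: haar_sum_half[OF c x] eq s_def)
  hence "(\<lambda>n. haar_sum \<epsilon> \<phi> n (half c x)) \<longlonglongrightarrow> t \<longleftrightarrow> (\<lambda>n. s + haar_sum \<delta> \<psi> n x) \<longlonglongrightarrow> t" for t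
    by (subst filterlim_sequentially_Suc[symmetric]) simp
  also have "(\<lambda>n. s + haar_sum \<delta> \<psi> n x) \<longlonglongrightarrow> t \<longleftrightarrow> (\<lambda>n. haar_sum \<delta> \<psi> n x) \<longlonglongrightarrow> t - s" for t
    using tendsto_add_const_iff[of s "\<lambda>n. haar_sum \<delta> \<psi> n x" "t - s"] by simp
  finally have lim: "(\<lambda>n. haar_sum \<epsilon> \<phi> n (half c x)) \<longlonglongrightarrow> t
    \<longleftrightarrow> (\<lambda>n. haar_sum \<delta> \<psi> n x) \<longlonglongrightarrow> t - s" for t .
  have "(\<exists>t\<ge>l. P (t - s)) \<longleftrightarrow> (\<exists>t\<ge>l - s. P t)" for P
  proof
    assume "\<exists>t\<ge>l - s. P t"
    then obtain t where "l - s \<le> t" "P t" by blast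
    thus "\<exists>t\<ge>l. P (t - s)" by (intro exI[of _ "t + s"]) simp
  qed (meson diff_right_mono)
  thus ?thesis unfolding limit_ge_def lim s_def[symmetric] .
qed

section \<open>The attained values and their supremum\<close>

definition Bellman_values :: "real \<Rightarrow> real \<Rightarrow> real \<Rightarrow> real set" where
  "Bellman_values l f F = {leb (superlevel_set \<epsilon> \<phi> l) | \<epsilon> \<phi>. \<epsilon> \<in> signs \<and> \<phi> \<in> admissible f F}"

lemma Bellman_eq_Sup: "Bellman l f F = Sup (Bellman_values l f F)"
proof -
  have "(\<lambda>(\<epsilon>, \<phi>). leb (superlevel_set \<epsilon> \<phi> l)) ` (signs \<times> admissible f F) = Bellman_values l f F"
    by (auto simp: Bellman_values_def)
  thus ?thesis by (simp add: Bellman_def)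
qed

text \<open>The means on the halves are \<open>f\<close> and \<open>f'\<close>, so the top
  coefficient is half their difference. Its sign is free and can move the common level to
  \<open>l\<close> on the left and to \<open>l'\<close> on the right.\<close>

lemma Bellman_values_glue:
  assumes v: "v \<in> Bellman_values l f F" "v' \<in> Bellman_values l' f' F'"
    and z: "\<bar>l - l'\<bar> = \<bar>f - f'\<bar>"
  shows "(v + v') / 2 \<in> Bellman_values ((l + l') / 2) ((f + f') / 2) ((F + F') / 2)"
proof -
  obtain \<epsilon> \<phi> where 1: "\<epsilon> \<in> signs" "\<phi> \<in> admissible f F" "v = leb (superlevel_set \<epsilon> \<phi> l)"
    using v(1) by (auto simp: Bellman_values_def)
  obtain \<delta> \<psi> where 2: "\<delta> \<in> signs" "\<psi> \<in> admissible f' F'" "v' = leb (superlevel_set \<delta> \<psi> l')"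
    using v(2) by (auto simp: Bellman_values_def)
  \<comment> \<open>Chosen so that \<open>\<sigma> * (f' - f) = l - l'\<close>, which is possible
    because both jumps have the same modulus.\<close>
  define \<sigma> :: real where "\<sigma> = (if l - l' = f' - f then 1 else -1)"
  have \<sigma>: "\<sigma> \<in> {-1, 1}" "\<sigma> * (f' - f) = l - l'" using z by (auto simp: \<sigma>_def)
  define \<eta> where "\<eta> = glue_signs \<sigma> \<epsilon> \<delta>"
  define \<theta> where "\<theta> = glue \<phi> \<psi>"
  have \<theta>: "\<theta> \<in> admissible ((f + f') / 2) ((F + F') / 2)"
    unfolding \<theta>_def using 1(2) 2(2) by (rule glue_admissible)
  hence int: "set_integrable lebesgue {0..<1} \<theta>" by (simp add: admissible_iff)
  have "mean (\<theta> \<circ> half 0) = mean \<phi>" "mean (\<theta> \<circ> half 1) = mean \<psi>"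
    unfolding \<theta>_def by (intro mean_cong glue_half_0 glue_half_1; assumption)+
  hence "mean (\<theta> \<circ> half 0) = f" "mean (\<theta> \<circ> half 1) = f'"
    using 1(2) 2(2) by (simp_all only: admissible_iff)
  hence jump: "\<eta> {0..<1} * haar_coeff \<theta> {0..<1} = (l - l') / 2"
    using \<sigma>(2) by (simp add: \<eta>_def glue_signs_def haar_coeff_unit[OF int])
  have e0: "haar_sum (\<eta> \<circ> (`) (half 0)) (\<theta> \<circ> half 0) n = haar_sum \<epsilon> \<phi> n" for n
    unfolding \<eta>_def \<theta>_def by (intro haar_sum_cong glue_signs_half_0 glue_half_0)
  have e1: "haar_sum (\<eta> \<circ> (`) (half 1)) (\<theta> \<circ> half 1) n = haar_sum \<delta> \<psi> n" for n
    unfolding \<eta>_def \<theta>_def by (intro haar_sum_cong glue_signs_half_1 glue_half_1)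
  have "(l + l') / 2 - (2 * 0 - 1) * \<eta> {0..<1} * haar_coeff \<theta> {0..<1} = l"
    "(l + l') / 2 - (2 * 1 - 1) * \<eta> {0..<1} * haar_coeff \<theta> {0..<1} = l'"
    using jump by (simp_all add: field_simps)
  hence "limit_ge \<eta> \<theta> ((l + l') / 2) (half 0 x) \<longleftrightarrow> limit_ge \<epsilon> \<phi> l x"
    "limit_ge \<eta> \<theta> ((l + l') / 2) (half 1 x) \<longleftrightarrow> limit_ge \<delta> \<psi> l' x" if "x \<in> {0..<1}" for x
    using limit_ge_glue[OF _ that e0] limit_ge_glue[OF _ that e1] by auto
  hence sets: "{x \<in> {0..<1}. limit_ge \<eta> \<theta> ((l + l') / 2) (half 0 x)} = {x \<in> {0..<1}. limit_ge \<epsilon> \<phi> l x}"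
    "{x \<in> {0..<1}. limit_ge \<eta> \<theta> ((l + l') / 2) (half 1 x)} = {x \<in> {0..<1}. limit_ge \<delta> \<psi> l' x}"
    by blast+
  have "leb (superlevel_set \<eta> \<theta> ((l + l') / 2)) = (v + v') / 2"
    unfolding leb_superlevel_set 1(3) 2(3) sets[symmetric]
    by (intro leb_halves; unfold sets; intro sets_unit_Collect measurable_limit_ge)
  moreover have "\<eta> \<in> signs" unfolding \<eta>_def using 1(1) 2(1) \<sigma>(1) by (rule glue_signs_in_signs)
  ultimately show ?thesis using \<theta> unfolding Bellman_values_def by force
qed

text \<open>A function equal to \<open>F\<close> on \<open>[0, p)\<close> and to \<open>- F\<close>
  on the rest has constant modulus; \<open>p\<close> tunes its mean to \<open>f\<close>.\<close>

lemma Bellman_values_nonempty: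
  assumes "\<bar>f\<bar> \<le> F"
  shows "Bellman_values l f F \<noteq> {}"
proof -
  txt \<open>For \<open>F = 0\<close> the division gives \<open>p = 0\<close>, which is still a correct choice.\<close>
  define p where "p = (F + f) / (2 * F)"
  have p: "0 \<le> p" "p \<le> 1" "(2 * p - 1) * F = f"
    using assms by (cases "F = 0"; auto simp: p_def divide_le_eq field_simps)+
  define \<phi> :: "real \<Rightarrow> real" where "\<phi> = (\<lambda>x. if x < p then F else - F)"
  have eq: "indicator {0..<1} x * \<phi> x = indicator {0..<p} x * F - indicator {p..<1} x * F" for x
    using p by (auto simp: \<phi>_def indicator_def)
  have int: "integrable lebesgue (\<lambda>x::real. indicator {a..<b} x * F)" for a b
    by (intro integrable_mult_left integrable_real_indicator)
      (cases "a \<le> b"; simp)+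
  have "set_integrable lebesgue {0..<1} \<phi>"
    unfolding set_integrable_def real_scaleR_def eq by (intro Bochner_Integration.integrable_diff int)
  moreover have "mean \<phi> = p * F - (1 - p) * F"
    unfolding mean_def set_lebesgue_integral_def real_scaleR_def eq
    by (subst Bochner_Integration.integral_diff) (use int p in auto)
  moreover have "(\<lambda>x. \<bar>\<phi> x\<bar>) = (\<lambda>x. F)" using assms by (auto simp: \<phi>_def)
  hence "mean (\<lambda>x. \<bar>\<phi> x\<bar>) = F" by (simp add: mean_def set_lebesgue_integral_def)
  ultimately have "\<phi> \<in> admissible f F" using p by (simp add: admissible_iff algebra_simps)
  moreover have "(\<lambda>_. 1) \<in> signs" by (simp add: signs_def)
  ultimately show ?thesis by (auto simp: Bellman_values_def)
qed

lemma Bellman_values_le_B0: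
  assumes "v \<in> Bellman_values l f F"
  shows "v \<le> B0 l f F"
  using assms leb_limit_ge_le
  by (auto simp: Bellman_values_def leb_superlevel_set admissible_iff)

text \<open>With nonemptiness this makes the real supremum a genuine least upper bound.\<close>

lemma bdd_above_Bellman_values: "bdd_above (Bellman_values l f F)"
  using Bellman_values_le_B0 by (rule bdd_aboveI)

text \<open>Any attained value gives nonnegativity, the zero function gives the value 1 at the
  origin, and gluing gives the midpoint inequality.\<close>

lemma zigzag_concave_Bellman: "zigzag_concave Bellman"
proof
  fix l f F :: real assume "\<bar>f\<bar> \<le> F"
  then obtain v where v: "v \<in> Bellman_values l f F" using Bellman_values_nonempty by blast
  hence "0 \<le> v" by (auto simp: Bellman_values_def)
  also have "v \<le> Bellman l f F"
    unfolding Bellman_eq_Sup using v bdd_above_Bellman_values by (rule cSup_upper)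
  finally show "0 \<le> Bellman l f F" .
next
  fix l :: real assume l: "l \<le> 0"
  have "haar_sum (\<lambda>_. 1) (\<lambda>_. 0) n x = 0" for n x
    by (simp add: haar_sum_def haar_coeff_def set_lebesgue_integral_def)
  hence "limit_ge (\<lambda>_. 1) (\<lambda>_. 0) l x" for x using l by (auto simp: limit_ge_def)
  hence "superlevel_set (\<lambda>_. 1) (\<lambda>_. 0) l = I0" by (simp add: superlevel_set_eq)
  hence "leb (superlevel_set (\<lambda>_. 1) (\<lambda>_. 0) l) = 1" by (simp add: I0_def)
  moreover have "(\<lambda>_. 0) \<in> admissible 0 0"
    by (simp add: admissible_iff mean_def set_integrable_def set_lebesgue_integral_def)
  moreover have "(\<lambda>_. 1) \<in> signs" by (simp add: signs_def)
  ultimately have "1 \<in> Bellman_values l 0 0" unfolding Bellman_values_def by force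
  thus "1 \<le> Bellman l 0 0" unfolding Bellman_eq_Sup using bdd_above_Bellman_values by (rule cSup_upper)
next
  fix l l' f f' F F' :: real
  assume d: "\<bar>f\<bar> \<le> F" "\<bar>f'\<bar> \<le> F'" and z: "\<bar>l - l'\<bar> = \<bar>f - f'\<bar>"
  define B where "B = Bellman ((l + l') / 2) ((f + f') / 2) ((F + F') / 2)"
  have "(v + v') / 2 \<le> B" if "v \<in> Bellman_values l f F" "v' \<in> Bellman_values l' f' F'" for v v'
    unfolding B_def Bellman_eq_Sup
    using Bellman_values_glue[OF that z] bdd_above_Bellman_values by (rule cSup_upper)
  \<comment> \<open>The supremum is taken over \<open>v\<close> with \<open>v'\<close> fixed, and
    afterwards over \<open>v'\<close>.\<close>
  hence "v \<le> 2 * B - v'" if "v \<in> Bellman_values l f F" "v' \<in> Bellman_values l' f' F'" for v v'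
    using that by (force simp: field_simps)
  hence "Bellman l f F \<le> 2 * B - v'" if "v' \<in> Bellman_values l' f' F'" for v'
    unfolding Bellman_eq_Sup using Bellman_values_nonempty[OF d(1)] that by (intro cSup_least)
  hence "v' \<le> 2 * B - Bellman l f F" if "v' \<in> Bellman_values l' f' F'" for v'
    using that by force
  hence "Bellman l' f' F' \<le> 2 * B - Bellman l f F"
    unfolding Bellman_eq_Sup[of l'] using Bellman_values_nonempty[OF d(2)] by (intro cSup_least)
  thus "(Bellman l f F + Bellman l' f' F') / 2 \<le> Bellman ((l + l') / 2) ((f + f') / 2) ((F + F') / 2)"
    by (simp add: B_def)
qed

theorem theorem2p1:
  fixes lam f F :: real
  assumes "(lam, f, F) \<in> Omega0"
  shows "Bellman lam f F = B0 lam f F"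
proof (rule antisym)
  have dom: "\<bar>f\<bar> \<le> F" using assms by (simp add: Omega0_def)
  show "Bellman lam f F \<le> B0 lam f F"
    unfolding Bellman_eq_Sup using Bellman_values_nonempty[OF dom] Bellman_values_le_B0 by (rule cSup_least)
  show "B0 lam f F \<le> Bellman lam f F"
    using zigzag_concave_Bellman dom by (rule zigzag_concave.B0_le)
qed

end
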